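(* Fix $\theta\in\mathbb R$ and choose $\beta=\beta_N$ such that $\sigma^2_{\beta_N}=\frac1{R_N}\big(1+\frac{\theta}{\log N}(1+o(1))\big)$ as $N\to\infty$. Then for any fixed $\delta>0$, $$\mathbb E[(Z_n^{\beta_N})^2]=\frac{(\log N)^2}{\pi N}\,G_\theta\big(\tfrac nN\big)(1+o(1))\quad\text{uniformly for }\delta N\le n\le N,$$ and there is $C\in(0,\infty)$ with $\mathbb E[(Z_n^{\beta_N})^2]\le C\frac{(\log N)^2}{N}G_\theta(\tfrac nN)$ for all $1\le n\le N$ (and all $N\ge2$).
   Context: $X=(X_n)_{n\ge0}$ is simple symmetric random walk on $\mathbb Z$ started at 0, with law $\P$ and expectation $\mathrm E$. $\omega=(\omega_n)_{n\in\mathbb N}$ are i.i.d., independent of $X$, with law $\mathbb P$, $\mathbb E[\omega_n]=0$, $\mathbb E[\omega_n^2]=1$, $\lambda(\beta):=\log\mathbb E[e^{\beta\omega_n}]<\infty$ for all $\beta>0$. $\sigma_\beta^2:=e^{\lambda(2\beta)-2\lambda(\beta)}-1$. The partition function is $Z_N^\beta:=\mathrm E\big[e^{\sum_{n=1}^{N-1}(\beta\omega_n-\lambda(\beta))\mathbf1_{\{X_{2n}=0\}}}\mathbf1_{\{X_{2N}=0\}}\big]$ (expectation over $X$ only). $R_N:=\sum_{n=1}^N\big\{2^{-2n}\binom{2n}{n}\big\}^2$. $G_\theta(t):=\int_0^\infty\frac{e^{(\theta-\gamma)s}s\,t^{s-1}}{\Gamma(s+1)}\mathrm ds$ for $t\in(0,1]$,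 $\gamma$ the Euler–Mascheroni constant. *)

theory Defs
  imports "HOL-Probability.Probability"
begin

definition lam :: "real measure \<Rightarrow> real \<Rightarrow> real" where
  "lam mu b = ln (\<integral>x. exp (b * x) \<partial>mu)"

definition sigma2 :: "real measure \<Rightarrow> real \<Rightarrow> real" where
  "sigma2 mu b = exp (lam mu (2 * b) - 2 * lam mu b) - 1"

definition RN :: "nat \<Rightarrow> real" where
  "RN N = (\<Sum>n=1..N. ((2::real) powr (- 2 * real n) * real ((2*n) choose n))^2)"

definition Gth :: "real \<Rightarrow> real \<Rightarrow> real" where
  "Gth th t = integral {0..} (\<lambda>s. exp ((th - euler_mascheroni) * s) * s * t powr (s - 1) / Gamma (s + 1))"

text \<open>Paths of simple symmetric random walk of length k (sequences of +-1 steps),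
  each with probability 2^(-k); position after j steps.\<close>
definition srw_paths :: "nat \<Rightarrow> int list set" where
  "srw_paths k = {xs. length xs = k \<and> set xs \<subseteq> {-1, 1}}"

definition pos :: "int list \<Rightarrow> nat \<Rightarrow> int" where
  "pos xs j = sum_list (take j xs)"

definition Zpf :: "real measure \<Rightarrow> real \<Rightarrow> (nat \<Rightarrow> real) \<Rightarrow> nat \<Rightarrow> real" where
  "Zpf mu b omega N =
     (\<Sum>xs\<in>srw_paths (2*N).
        exp (\<Sum>n=1..N-1. (b * omega n - lam mu b) * (if pos xs (2*n) = 0 then 1 else 0))
        * (if pos xs (2*N) = 0 then 1 else 0)) / 2 ^ (2*N)"

definition Z2 :: "real measure \<Rightarrow> real \<Rightarrow> nat \<Rightarrow> real" where
  "Z2 mu b N = (\<integral>omega. (Zpf mu b omega N)^2 \<partial>(PiM (UNIV::nat set) (\<lambda>_. mu)))"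

end

theory Submission
  imports Defs "HOL-Real_Asymp.Real_Asymp" "HOL-Computational_Algebra.Formal_Power_Series"
begin

text \<open>
  Expanding the square of the partition function over two independent walks gives the renewal equation
  \<open>W = A + s A W\<close> for the generating function \<open>W\<close> of the second moments, where \<open>s\<close> is the variance parameter and
  \<open>A\<close> has the coefficients \<open>a(n) = (4^(-n) binom(2n, n))^2 = 1 / (pi n) + O(1 / n^2)\<close>. Hence
  \<open>pi A = L + c + E\<close> with \<open>L = ln (1 / (1 - z))\<close>, a constant \<open>c\<close>, and \<open>E\<close> with coefficients of order \<open>1 / n^2\<close>
  and sum zero. Up to normalisation \<open>W\<close> is therefore \<open>1 / (k - L - E)\<close> with \<open>k = pi / s - c = ln N + gamma - theta + o(1)\<close>.

  For \<open>E = 0\<close> the solution is explicit: \<open>V = 1 / (k - L)\<close> is the integral of \<open>exp (- k x) (1 - z)^(- x)\<close> over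
  \<open>x > 0\<close>, whose coefficients \<open>v(n)\<close> are integrals of \<open>exp (- k x) Gamma(n + x) / (Gamma(x) n!)\<close>, and dominated convergence
  turns \<open>N v(n)\<close> into \<open>G(n / N)\<close>. Since \<open>E\<close> sums to zero, the coefficients of \<open>E V\<close> are
  \<open>O(n^(-3/2) / ln N)\<close>, so that passing from \<open>V\<close> to \<open>V / (1 - E V)\<close> is a negligible perturbation.
\<close>

section \<open>The renewal equation for the second moment\<close>

lemma integral_PiM_prod_finite:
  fixes M :: "'i \<Rightarrow> 'a measure" and f :: "'i \<Rightarrow> 'a \<Rightarrow> real"
  assumes M: "\<And>i. prob_space (M i)" and J: "finite J"
    and f: "\<And>i. i \<in> J \<Longrightarrow> integrable (M i) (f i)"
  shows "integrable (PiM UNIV M) (\<lambda>x. \<Prod>i\<in>J. f i (x i))"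
    and "(\<integral>x. (\<Prod>i\<in>J. f i (x i)) \<partial>PiM UNIV M) = (\<Prod>i\<in>J. \<integral>x. f i x \<partial>M i)"
proof -
  interpret prob_space "M i" for i by (rule M)
  interpret product_sigma_finite M by standard
  let ?t = "\<lambda>x. \<lambda>n\<in>J. x n"
  have d: "distr (PiM UNIV M) (PiM J M) ?t = PiM J M"
    using distr_PiM_reindex[of UNIV M "\<lambda>i. i" J] M by simp
  have t: "?t \<in> measurable (PiM UNIV M) (PiM J M)" by measurable
  have i: "integrable (PiM J M) (\<lambda>x. \<Prod>i\<in>J. f i (x i))"
    by (rule product_integrable_prod[OF J f])
  have i': "integrable (distr (PiM UNIV M) (PiM J M) ?t) (\<lambda>x. \<Prod>i\<in>J. f i (x i))"
    using i d by simp
  have "integrable (PiM UNIV M) (\<lambda>x. \<Prod>i\<in>J. f i (?t x i))"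
    using integrable_distr[OF t i'] .
  then show "integrable (PiM UNIV M) (\<lambda>x. \<Prod>i\<in>J. f i (x i))"
    by simp
  have "(\<Prod>i\<in>J. \<integral>x. f i x \<partial>M i) = (\<integral>x. (\<Prod>i\<in>J. f i (x i)) \<partial>PiM J M)"
    by (rule product_integral_prod[OF J f, symmetric])
  also have "\<dots> = (\<integral>x. (\<Prod>i\<in>J. f i (x i)) \<partial>distr (PiM UNIV M) (PiM J M) ?t)"
    using d by simp
  also have "\<dots> = (\<integral>x. (\<Prod>i\<in>J. f i (?t x i)) \<partial>PiM UNIV M)"
    by (rule integral_distr[OF t borel_measurable_integrable[OF i]])
  finally show "(\<integral>x. (\<Prod>i\<in>J. f i (x i)) \<partial>PiM UNIV M) = (\<Prod>i\<in>J. \<integral>x. f i x \<partial>M i)"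
    by simp
qed

lemma finite_srw_paths: "finite (srw_paths k)"
proof -
  have "srw_paths k = {xs. set xs \<subseteq> {-1, 1} \<and> length xs = k}"
    by (auto simp: srw_paths_def)
  then show ?thesis by (simp add: finite_lists_length_eq)
qed

lemma srw_paths_Suc: "srw_paths (Suc k) = (\<lambda>xs. 1 # xs) ` srw_paths k \<union> (\<lambda>xs. -1 # xs) ` srw_paths k"
proof (intro set_eqI iffI)
  fix xs assume "xs \<in> srw_paths (Suc k)"
  then show "xs \<in> (\<lambda>xs. 1 # xs) ` srw_paths k \<union> (\<lambda>xs. -1 # xs) ` srw_paths k"
    by (cases xs) (auto simp: srw_paths_def)
qed (auto simp: srw_paths_def)

lemma sum_srw_paths_ge: "xs \<in> srw_paths k \<Longrightarrow> sum_list xs \<ge> - int k"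
proof (induction k arbitrary: xs)
  case (Suc k)
  then obtain ys where "ys \<in> srw_paths k" "xs = 1 # ys \<or> xs = -1 # ys"
    by (auto simp: srw_paths_Suc)
  then show ?case using Suc.IH[of ys] by auto
qed (simp add: srw_paths_def)

lemma card_srw_paths_Suc:
  "card {xs \<in> srw_paths (Suc k). sum_list xs = z} =
     card {xs \<in> srw_paths k. sum_list xs = z - 1} + card {xs \<in> srw_paths k. sum_list xs = z + 1}"
proof -
  have "{xs \<in> srw_paths (Suc k). sum_list xs = z} =
     (\<lambda>xs. 1 # xs) ` {xs \<in> srw_paths k. sum_list xs = z - 1} \<union>
     (\<lambda>xs. -1 # xs) ` {xs \<in> srw_paths k. sum_list xs = z + 1}"
    by (auto simp: srw_paths_Suc)
  also have "card \<dots> = card ((\<lambda>xs. 1 # xs) ` {xs \<in> srw_paths k. sum_list xs = z - 1}) +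
      card ((\<lambda>xs. -1 # xs) ` {xs \<in> srw_paths k. sum_list xs = z + 1})"
    by (rule card_Un_disjoint) (auto simp: finite_srw_paths)
  also have "\<dots> = card {xs \<in> srw_paths k. sum_list xs = z - 1} + card {xs \<in> srw_paths k. sum_list xs = z + 1}"
    by (simp add: card_image inj_on_def)
  finally show ?thesis .
qed

lemma card_srw_paths: "card {xs \<in> srw_paths k. sum_list xs = 2 * int j - int k} = k choose j"
proof (induction k arbitrary: j)
  case 0
  have "{xs \<in> srw_paths 0. sum_list xs = 2 * int j - int 0} = (if j = 0 then {[]} else {})"
    by (auto simp: srw_paths_def)
  then show ?case by (cases j) (simp_all only:, simp_all)
next
  case (Suc k)
  show ?case
  proof (cases j)
    case 0
    have "{xs \<in> srw_paths k. sum_list xs = 2 * int j - int (Suc k) - 1} = {}"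
      using 0 sum_srw_paths_ge by fastforce
    moreover have "2 * int j - int (Suc k) + 1 = 2 * int 0 - int k" using 0 by simp
    ultimately show ?thesis
      using 0 Suc.IH[of 0] by (simp only: card_srw_paths_Suc card.empty) simp
  next
    case (Suc i)
    have "2 * int j - int (Suc k) - 1 = 2 * int i - int k" "2 * int j - int (Suc k) + 1 = 2 * int j - int k"
      using Suc by simp_all
    then show ?thesis
      using Suc.IH[of i] Suc.IH[of j] by (simp only: card_srw_paths_Suc Suc binomial_Suc_Suc)
  qed
qed

lemma card_srw_bridges: "card {xs \<in> srw_paths (2 * k). sum_list xs = 0} = (2 * k) choose k"
  using card_srw_paths[of "2 * k" k] by simp

lemma srw_paths_add: "bij_betw (\<lambda>(xs, ys). xs @ ys) (srw_paths k \<times> srw_paths l) (srw_paths (k + l))"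
proof (rule bij_betwI[where g = "\<lambda>xs. (take k xs, drop k xs)"])
  show "(\<lambda>xs. (take k xs, drop k xs)) \<in> srw_paths (k + l) \<rightarrow> srw_paths k \<times> srw_paths l"
    using set_take_subset set_drop_subset by (fastforce simp: srw_paths_def)
qed (auto simp: srw_paths_def)

lemma sum_srw_paths_add:
  "(\<Sum>xs\<in>srw_paths (k + l). f xs) = (\<Sum>xs\<in>srw_paths k. \<Sum>ys\<in>srw_paths l. f (xs @ ys))"
proof -
  have "(\<Sum>xs\<in>srw_paths (k + l). f xs) = (\<Sum>p\<in>srw_paths k \<times> srw_paths l. f ((\<lambda>(xs, ys). xs @ ys) p))"
    by (rule sum.reindex_bij_betw[OF srw_paths_add, symmetric])
  then show ?thesis by (simp add: sum.cartesian_product case_prod_unfold)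
qed

definition meet :: "int list \<Rightarrow> int list \<Rightarrow> nat \<Rightarrow> real" where
  "meet xs ys n = of_bool (pos xs (2 * n) = 0 \<and> pos ys (2 * n) = 0)"

definition meet_weight :: "real \<Rightarrow> nat \<Rightarrow> real" where
  "meet_weight s N = (\<Sum>xs\<in>srw_paths (2 * N). \<Sum>ys\<in>srw_paths (2 * N).
      (\<Prod>n=1..N-1. 1 + s * meet xs ys n) * meet xs ys N)"

lemma prod_one_plus_expand:
  fixes x :: "nat \<Rightarrow> real"
  shows "(\<Prod>n=1..N. 1 + x n) = 1 + (\<Sum>m=1..N. x m * (\<Prod>n=1..m-1. 1 + x n))"
  by (induction N) (auto simp: algebra_simps)

lemma sum_meet: "(\<Sum>xs\<in>srw_paths (2 * k). \<Sum>ys\<in>srw_paths (2 * k). meet xs ys k) = real ((2 * k) choose k) ^ 2"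
proof -
  have "meet xs ys k = of_bool (sum_list xs = 0) * of_bool (sum_list ys = 0)"
    if "xs \<in> srw_paths (2 * k)" "ys \<in> srw_paths (2 * k)" for xs ys
    using that by (auto simp: meet_def pos_def srw_paths_def)
  then have "(\<Sum>xs\<in>srw_paths (2 * k). \<Sum>ys\<in>srw_paths (2 * k). meet xs ys k) =
     (\<Sum>xs\<in>srw_paths (2 * k). of_bool (sum_list xs = 0)) * (\<Sum>ys\<in>srw_paths (2 * k). of_bool (sum_list ys = 0))"
    by (simp add: sum_product)
  also have "(\<Sum>xs\<in>srw_paths (2 * k). of_bool (sum_list xs = 0)) = real ((2 * k) choose k)"
    using finite_srw_paths by (simp add: sum_of_bool_eq Int_def card_srw_bridges)
  finally show ?thesis by (simp add: power2_eq_square)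
qed

lemma meet_append:
  assumes "xs \<in> srw_paths (2 * m)" "ys \<in> srw_paths (2 * m)"
  shows "n \<le> m \<Longrightarrow> meet (xs @ xs') (ys @ ys') n = meet xs ys n"
    and "meet xs ys m * meet (xs @ xs') (ys @ ys') (m + k) = meet xs ys m * meet xs' ys' k"
  using assms by (auto simp: meet_def pos_def srw_paths_def)

lemma meet_weight_renewal:
  "meet_weight s N = real ((2 * N) choose N) ^ 2 +
     s * (\<Sum>m=1..N-1. meet_weight s m * real ((2 * (N - m)) choose (N - m)) ^ 2)"
proof -
  have split: "(\<Sum>xs\<in>srw_paths (2 * N). \<Sum>ys\<in>srw_paths (2 * N).
        meet xs ys m * (\<Prod>n=1..m-1. 1 + s * meet xs ys n) * meet xs ys N) =
      meet_weight s m * real ((2 * (N - m)) choose (N - m)) ^ 2"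
    if m: "m \<in> {1..N-1}" for m
  proof -
    define k where "k = N - m"
    have N: "N = m + k" using m by (auto simp: k_def)
    have "(\<Sum>xs\<in>srw_paths (2 * N). \<Sum>ys\<in>srw_paths (2 * N).
        meet xs ys m * (\<Prod>n=1..m-1. 1 + s * meet xs ys n) * meet xs ys N) =
      (\<Sum>xs\<in>srw_paths (2 * m). \<Sum>xs'\<in>srw_paths (2 * k). \<Sum>ys\<in>srw_paths (2 * m). \<Sum>ys'\<in>srw_paths (2 * k).
         meet (xs @ xs') (ys @ ys') m * (\<Prod>n=1..m-1. 1 + s * meet (xs @ xs') (ys @ ys') n)
          * meet (xs @ xs') (ys @ ys') N)"
      unfolding N distrib_left sum_srw_paths_add by simp
    also have "\<dots> = (\<Sum>xs\<in>srw_paths (2 * m). \<Sum>xs'\<in>srw_paths (2 * k). \<Sum>ys\<in>srw_paths (2 * m). \<Sum>ys'\<in>srw_paths (2 * k).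
         ((\<Prod>n=1..m-1. 1 + s * meet xs ys n) * meet xs ys m) * meet xs' ys' k)"
    proof (intro sum.cong refl)
      fix xs xs' ys ys'
      assume *: "xs \<in> srw_paths (2 * m)" "ys \<in> srw_paths (2 * m)"
      have 1: "meet (xs @ xs') (ys @ ys') m = meet xs ys m" by (rule meet_append[OF *]) simp
      have 2: "(\<Prod>n=1..m-1. 1 + s * meet (xs @ xs') (ys @ ys') n) = (\<Prod>n=1..m-1. 1 + s * meet xs ys n)"
        by (intro prod.cong refl) (subst meet_append(1)[OF *], auto)
      show "meet (xs @ xs') (ys @ ys') m * (\<Prod>n=1..m-1. 1 + s * meet (xs @ xs') (ys @ ys') n)
          * meet (xs @ xs') (ys @ ys') N = ((\<Prod>n=1..m-1. 1 + s * meet xs ys n) * meet xs ys m) * meet xs' ys' k"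
        unfolding 1 2 N using meet_append(2)[OF *, of xs' ys' k] by auto
    qed
    also have "\<dots> = (\<Sum>xs\<in>srw_paths (2 * m). \<Sum>ys\<in>srw_paths (2 * m). \<Sum>xs'\<in>srw_paths (2 * k). \<Sum>ys'\<in>srw_paths (2 * k).
         ((\<Prod>n=1..m-1. 1 + s * meet xs ys n) * meet xs ys m) * meet xs' ys' k)"
      by (intro sum.cong refl sum.swap)
    also have "\<dots> = meet_weight s m * (\<Sum>xs'\<in>srw_paths (2 * k). \<Sum>ys'\<in>srw_paths (2 * k). meet xs' ys' k)"
      by (simp only: meet_weight_def sum_distrib_right[symmetric] sum_distrib_left[symmetric])
    finally show ?thesis by (simp add: sum_meet k_def)
  qed
  have "meet_weight s N = (\<Sum>xs\<in>srw_paths (2 * N). \<Sum>ys\<in>srw_paths (2 * N). meet xs ys N +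
      s * (\<Sum>m=1..N-1. meet xs ys m * (\<Prod>n=1..m-1. 1 + s * meet xs ys n) * meet xs ys N))"
    unfolding meet_weight_def
    by (subst prod_one_plus_expand) (simp add: distrib_right sum_distrib_left sum_distrib_right mult.assoc)
  also have "\<dots> = real ((2 * N) choose N) ^ 2 + s * (\<Sum>xs\<in>srw_paths (2 * N). \<Sum>ys\<in>srw_paths (2 * N).
     (\<Sum>m=1..N-1. meet xs ys m * (\<Prod>n=1..m-1. 1 + s * meet xs ys n) * meet xs ys N))"
    by (simp add: sum.distrib sum_meet sum_distrib_left)
  also have "(\<Sum>xs\<in>srw_paths (2 * N). \<Sum>ys\<in>srw_paths (2 * N).
     (\<Sum>m=1..N-1. meet xs ys m * (\<Prod>n=1..m-1. 1 + s * meet xs ys n) * meet xs ys N)) =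
     (\<Sum>xs\<in>srw_paths (2 * N). \<Sum>m=1..N-1. \<Sum>ys\<in>srw_paths (2 * N).
      meet xs ys m * (\<Prod>n=1..m-1. 1 + s * meet xs ys n) * meet xs ys N)"
    by (intro sum.cong refl, rule sum.swap)
  also have "\<dots> = (\<Sum>m=1..N-1. \<Sum>xs\<in>srw_paths (2 * N). \<Sum>ys\<in>srw_paths (2 * N).
      meet xs ys m * (\<Prod>n=1..m-1. 1 + s * meet xs ys n) * meet xs ys N)"
    by (rule sum.swap)
  also have "\<dots> = (\<Sum>m=1..N-1. meet_weight s m * real ((2 * (N - m)) choose (N - m)) ^ 2)"
    by (intro sum.cong refl split)
  finally show ?thesis .
qed

lemma Z2_eq_meet_weight:
  fixes mu :: "real measure"
  assumes mu: "prob_space mu"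
    and exp_int: "\<And>b. b > 0 \<Longrightarrow> integrable mu (\<lambda>x. exp (b * x))" and b: "b > 0"
  shows "Z2 mu b N = meet_weight (sigma2 mu b) N / 16 ^ N"
proof -
  interpret prob_space mu by fact
  define J where "J = {1..N-1}"
  have J: "finite J" by (simp add: J_def)
  define c where "c xs n = (if pos xs (2 * n) = 0 then 1 else (0::real))" for xs n
  define F where "F xs ys n x = exp ((b * x - lam mu b) * (c xs n + c ys n))" for xs ys n and x :: real
  have exp_lam: "exp (lam mu t) = (\<integral>x. exp (t * x) \<partial>mu)" if "t > 0" for t
  proof -
    have "(\<integral>x. exp (t * x) \<partial>mu) > 0"
      using integral_nonneg_eq_0_iff_AE[OF exp_int[OF that]]
      by (simp add: order_less_le AE_False)
    then show ?thesis by (simp add: lam_def)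
  qed
  have F: "integrable mu (F xs ys n) \<and> (\<integral>x. F xs ys n x \<partial>mu) = 1 + sigma2 mu b * meet xs ys n" for xs ys n
  proof -
    consider "c xs n + c ys n = 0" "meet xs ys n = 0" | "c xs n + c ys n = 1" "meet xs ys n = 0"
      | "c xs n + c ys n = 2" "meet xs ys n = 1"
      by (cases "pos xs (2 * n) = 0"; cases "pos ys (2 * n) = 0") (auto simp: c_def meet_def)
    then show ?thesis
    proof cases
      case 1
      then have "F xs ys n = (\<lambda>_. 1)" by (simp add: F_def fun_eq_iff)
      then show ?thesis using 1 by (simp add: prob_space)
    next
      case 2
      have "F xs ys n = (\<lambda>x. exp (- lam mu b) * exp (b * x))"
        using 2 by (simp add: F_def fun_eq_iff exp_add[symmetric])
      then show ?thesis
        using 2 exp_int[OF b] exp_lam[OF b, symmetric] by (simp add: exp_minus)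
    next
      case 3
      have "F xs ys n = (\<lambda>x. exp (- 2 * lam mu b) * exp (2 * b * x))"
        using 3 by (simp add: F_def fun_eq_iff exp_add[symmetric] algebra_simps)
      then show ?thesis
        using 3 exp_int[of "2 * b"] exp_lam[of "2 * b", symmetric] b
        by (simp add: exp_minus exp_diff sigma2_def field_simps)
    qed
  qed
  have meet_c: "c xs n * c ys n = meet xs ys n" for xs ys n
    by (auto simp: c_def meet_def)
  have prod_F: "(exp (\<Sum>n\<in>J. (b * \<omega> n - lam mu b) * c xs n) * c xs N) *
      (exp (\<Sum>n\<in>J. (b * \<omega> n - lam mu b) * c ys n) * c ys N) =
      (\<Prod>n\<in>J. F xs ys n (\<omega> n)) * meet xs ys N" for xs ys \<omega>
    using J by (simp add: F_def exp_sum prod.distrib exp_add distrib_left meet_c[symmetric])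
  have "(Zpf mu b \<omega> N)\<^sup>2 = (\<Sum>xs\<in>srw_paths (2 * N). \<Sum>ys\<in>srw_paths (2 * N).
      (\<Prod>n\<in>J. F xs ys n (\<omega> n)) * meet xs ys N) / 16 ^ N" for \<omega>
  proof -
    have "((2::real) ^ (2 * N))\<^sup>2 = 16 ^ N"
      by (simp add: power_mult[symmetric] power_mult power_mult_distrib[symmetric] power2_eq_square)
    then have "(Zpf mu b \<omega> N)\<^sup>2 = (\<Sum>xs\<in>srw_paths (2 * N). \<Sum>ys\<in>srw_paths (2 * N).
      (exp (\<Sum>n\<in>J. (b * \<omega> n - lam mu b) * c xs n) * c xs N) *
      (exp (\<Sum>n\<in>J. (b * \<omega> n - lam mu b) * c ys n) * c ys N)) / 16 ^ N"
      by (simp add: Zpf_def c_def J_def power_divide power2_eq_square sum_product)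
    then show ?thesis by (simp only: prod_F)
  qed
  moreover have int: "integrable (PiM UNIV (\<lambda>_. mu)) (\<lambda>\<omega>. \<Prod>n\<in>J. F xs ys n (\<omega> n))" for xs ys
    by (rule integral_PiM_prod_finite(1)) (simp_all add: mu J F)
  ultimately have "Z2 mu b N = (\<integral>\<omega>. (\<Sum>xs\<in>srw_paths (2 * N). \<Sum>ys\<in>srw_paths (2 * N).
      (\<Prod>n\<in>J. F xs ys n (\<omega> n)) * meet xs ys N) / 16 ^ N \<partial>PiM UNIV (\<lambda>_. mu))"
    by (simp add: Z2_def)
  also have "\<dots> = (\<Sum>xs\<in>srw_paths (2 * N). \<Sum>ys\<in>srw_paths (2 * N).
      (\<integral>\<omega>. (\<Prod>n\<in>J. F xs ys n (\<omega> n)) \<partial>PiM UNIV (\<lambda>_. mu)) * meet xs ys N) / 16 ^ N"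
    by (simp add: int Bochner_Integration.integral_sum)
  also have "\<dots> = meet_weight (sigma2 mu b) N / 16 ^ N"
    using integral_PiM_prod_finite(2)[of "\<lambda>_. mu" "J" "F xs ys" for xs ys, OF mu J]
    by (simp add: F[THEN conjunct1] F[THEN conjunct2] meet_weight_def J_def)
  finally show ?thesis .
qed

text \<open>The probability that two independent walks are both at the origin at time \<open>2n\<close>.\<close>

definition ret2 :: "nat \<Rightarrow> real" where
  "ret2 n = (real ((2 * n) choose n) / 4 ^ n)\<^sup>2"

lemma RN_eq: "RN N = (\<Sum>n=1..N. ret2 n)"
proof -
  have "(2::real) powr (- 2 * real n) = 1 / 4 ^ n" for n
  proof -
    have "(2::real) powr (- 2 * real n) = 1 / 2 powr (real (2 * n))"
      by (simp add: powr_minus_divide)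
    also have "\<dots> = 1 / 4 ^ n"
      by (subst powr_realpow) (simp_all add: power_mult)
    finally show ?thesis .
  qed
  then show ?thesis by (simp add: RN_def ret2_def)
qed

lemma Z2_renewal:
  fixes mu :: "real measure"
  assumes "prob_space mu"
    and "\<And>b. b > 0 \<Longrightarrow> integrable mu (\<lambda>x. exp (b * x))" and "b > 0"
  shows "Z2 mu b N = ret2 N + sigma2 mu b * (\<Sum>m=1..N-1. Z2 mu b m * ret2 (N - m))"
proof -
  have Z: "Z2 mu b n = meet_weight (sigma2 mu b) n / 16 ^ n" for n
    using Z2_eq_meet_weight assms(1-3) by blast
  have r: "ret2 n = real ((2 * n) choose n) ^ 2 / 16 ^ n" for n
    by (simp add: ret2_def power_divide power_mult_distrib[symmetric] power2_eq_square)
  have "(16::real) ^ N = 16 ^ m * 16 ^ (N - m)" if "m \<in> {1..N-1}" for m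
    using that by (subst power_add[symmetric]) (auto intro!: arg_cong[of _ _ "power 16"])
  then have "(\<Sum>m=1..N-1. Z2 mu b m * ret2 (N - m)) =
     (\<Sum>m=1..N-1. meet_weight (sigma2 mu b) m * real ((2 * (N - m)) choose (N - m)) ^ 2) / 16 ^ N"
    unfolding r sum_divide_distrib by (intro sum.cong refl) (simp add: Z)
  then show ?thesis
    unfolding Z r meet_weight_renewal[of _ N] by (simp add: add_divide_distrib)
qed

section \<open>Return probabilities\<close>

lemma ret2_0 [simp]: "ret2 0 = 1" by (simp add: ret2_def)

lemma ret2_nonneg: "ret2 n \<ge> 0" by (simp add: ret2_def)

lemma ret2_Suc: "ret2 (Suc n) = ret2 n * ((2 * real n + 1) / (2 * real n + 2))\<^sup>2"
proof -
  have "real ((2 * Suc n) choose Suc n) = real ((2 * n) choose n) * (2 * (2 * real n + 1) / (real n + 1))"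
  proof -
    have central: "real ((2 * k) choose k) = fact (2 * k) / (fact k * fact k)" for k
      using binomial_fact[of k "2 * k", where 'a = real] by simp
    have "(fact (2 * Suc n) :: real) = (2 * real n + 2) * (2 * real n + 1) * fact (2 * n)"
      by (simp add: algebra_simps)
    moreover have "(fact (Suc n) :: real) = (real n + 1) * fact n"
      by (simp add: algebra_simps)
    ultimately show ?thesis
      unfolding central by (simp only:) (simp add: divide_simps, simp add: algebra_simps)
  qed
  then have "real ((2 * Suc n) choose Suc n) / 4 ^ Suc n =
      real ((2 * n) choose n) / 4 ^ n * ((2 * real n + 1) / (2 * real n + 2))"
    by (simp only:) (simp add: divide_simps, simp add: algebra_simps)
  then show ?thesis by (simp only: ret2_def power_mult_distrib)
qed

lemma ret2_pos: "ret2 n > 0"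
  by (induction n) (auto simp: ret2_Suc)

lemma wallis_ret2: "(\<Prod>k=1..n. (4 * real k ^ 2) / (4 * real k ^ 2 - 1)) = 1 / ((2 * real n + 1) * ret2 n)"
proof (induction n)
  case (Suc n)
  have "4 * real (Suc n) ^ 2 - 1 = (2 * real n + 1) * (2 * real n + 3)"
    by (simp add: power2_eq_square algebra_simps)
  moreover have "4 * real (Suc n) ^ 2 = (2 * real n + 2)\<^sup>2"
    by (simp add: power2_eq_square algebra_simps)
  ultimately have "(\<Prod>k=1..Suc n. (4 * real k ^ 2) / (4 * real k ^ 2 - 1)) =
     (1 / ((2 * real n + 1) * ret2 n)) * ((2 * real n + 2)\<^sup>2 / ((2 * real n + 1) * (2 * real n + 3)))"
    using Suc by simp
  also have "\<dots> = 1 / ((2 * real (Suc n) + 1) * ret2 (Suc n))"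
    using ret2_pos[of n] by (simp add: ret2_Suc divide_simps power2_eq_square)
  finally show ?case .
qed simp

lemma ret2_half_LIMSEQ: "(\<lambda>n. (real n + 1/2) * ret2 n) \<longlonglongrightarrow> 1 / pi"
proof -
  have "(\<lambda>n. 1 / (2 * (1 / ((2 * real n + 1) * ret2 n)))) \<longlonglongrightarrow> 1 / (2 * (pi / 2))"
    by (rule tendsto_divide[OF tendsto_const tendsto_mult[OF tendsto_const wallis[unfolded wallis_ret2]]]) simp
  then show ?thesis by (simp add: field_simps)
qed

lemma ret2_LIMSEQ: "(\<lambda>n. real n * ret2 n) \<longlonglongrightarrow> 1 / pi"
proof -
  have "(\<lambda>n. real n / (real n + 1/2)) \<longlonglongrightarrow> 1" by real_asymp
  from tendsto_mult[OF this ret2_half_LIMSEQ]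
  have "(\<lambda>n. real n / (real n + 1/2) * ((real n + 1/2) * ret2 n)) \<longlonglongrightarrow> 1 / pi" by simp
  moreover have "real n / (real n + 1/2) * ((real n + 1/2) * ret2 n) = real n * ret2 n" for n
    by (simp add: field_simps)
  ultimately show ?thesis by simp
qed

lemma ret2_bounds:
  assumes "n \<ge> 1"
  shows "1 / (pi * (real n + 1/2)) \<le> ret2 n" "ret2 n \<le> 1 / (pi * real n)"
proof -
  have "decseq (\<lambda>n. (real n + 1/2) * ret2 n)"
  proof (rule decseq_SucI)
    fix n
    have "(real (Suc n) + 1/2) * ((2 * real n + 1) / (2 * real n + 2))\<^sup>2 \<le> real n + 1/2"
      by (simp add: divide_simps power2_eq_square) (simp add: algebra_simps)
    from mult_left_mono[OF this ret2_nonneg[of n]]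
    show "(real (Suc n) + 1/2) * ret2 (Suc n) \<le> (real n + 1/2) * ret2 n"
      by (simp add: ret2_Suc mult_ac)
  qed
  from decseq_ge[OF this ret2_half_LIMSEQ, of n] show "1 / (pi * (real n + 1/2)) \<le> ret2 n"
    by (simp add: pos_divide_le_eq[of "pi * (real n + 1/2)"] pos_divide_le_eq[of pi] add_pos_nonneg mult_ac)
  have "incseq (\<lambda>n. real n * ret2 n)"
  proof (rule incseq_SucI)
    fix n
    have "real n \<le> real (Suc n) * ((2 * real n + 1) / (2 * real n + 2))\<^sup>2"
      by (simp add: divide_simps power2_eq_square) (simp add: algebra_simps)
    from mult_left_mono[OF this ret2_nonneg[of n]]
    show "real n * ret2 n \<le> real (Suc n) * ret2 (Suc n)"
      by (simp add: ret2_Suc mult_ac)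
  qed
  from incseq_le[OF this ret2_LIMSEQ, of n] assms show "ret2 n \<le> 1 / (pi * real n)"
    by (simp add: field_simps)
qed

definition dev_sum :: real where
  "dev_sum = (\<Sum>j. pi * ret2 (Suc j) - 1 / real (Suc j))"

text \<open>The value at \<open>0\<close> makes the coefficients sum to zero; this cancellation is what makes the perturbation
  of the explicitly solvable renewal equation small.\<close>

definition dev :: "nat \<Rightarrow> real" where
  "dev n = (if n = 0 then - dev_sum else pi * ret2 n - 1 / real n)"

lemma abs_dev_le:
  assumes "n \<ge> 1"
  shows "\<bar>dev n\<bar> \<le> 1 / (real n)\<^sup>2"
proof -
  have n: "real n \<ge> 1" using assms by simp
  have "pi * ret2 n \<le> 1 / real n"
    using ret2_bounds(2)[OF assms] n by (simp add: field_simps)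
  moreover have "1 / (real n + 1/2) \<le> pi * ret2 n"
    using ret2_bounds(1)[OF assms] n by (simp add: pos_divide_le_eq mult_ac)
  moreover have "1 / real n - 1 / (real n + 1/2) \<le> 1 / (real n)\<^sup>2"
    using n by (simp add: divide_simps power2_eq_square)
  ultimately show ?thesis using assms by (simp add: dev_def)
qed

lemma sum_dev_LIMSEQ: "(\<lambda>n. \<Sum>j\<le>n. dev j) \<longlonglongrightarrow> 0"
proof -
  have "summable (\<lambda>j. dev (Suc j))"
  proof (rule summable_comparison_test)
    show "summable (\<lambda>j. 1 / (real (Suc j))\<^sup>2)"
      using inverse_squares_sums by (auto simp: sums_iff add_ac)
    show "\<exists>N. \<forall>n\<ge>N. norm (dev (Suc n)) \<le> 1 / (real (Suc n))\<^sup>2"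
      using abs_dev_le by (metis One_nat_def le_add1 plus_1_eq_Suc real_norm_def)
  qed
  moreover have "dev_sum = (\<Sum>j. dev (Suc j))" by (simp add: dev_sum_def dev_def)
  ultimately have "(\<lambda>j. dev (Suc j)) sums dev_sum" using summable_sums by metis
  then have "(\<lambda>n. dev 0 + (\<Sum>j<n. dev (Suc j))) \<longlonglongrightarrow> dev 0 + dev_sum"
    unfolding sums_def by (intro tendsto_intros)
  then show ?thesis
    by (simp add: sum.atMost_shift dev_def)
qed

lemma abs_sum_dev_le:
  assumes n: "n \<ge> 1"
  shows "\<bar>\<Sum>j\<le>n. dev j\<bar> \<le> 1 / real n"
proof -
  have "\<bar>(\<Sum>j\<le>m. dev j) - (\<Sum>j\<le>n. dev j)\<bar> \<le> 1 / real n - 1 / real m" if "m \<ge> n" for m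
    using that
  proof (induction m rule: dec_induct)
    case (step m)
    have m: "real m \<ge> 1" using step n by simp
    have "\<bar>dev (Suc m)\<bar> \<le> 1 / (real m + 1)\<^sup>2" using abs_dev_le[of "Suc m"] by (simp add: add_ac)
    also have "\<dots> \<le> 1 / real m - 1 / (real m + 1)"
      using m by (simp add: divide_simps power2_eq_square)
    finally show ?case using step.IH by (simp add: add_ac)
  qed simp
  then have "\<forall>\<^sub>F m in sequentially. \<bar>(\<Sum>j\<le>m. dev j) - (\<Sum>j\<le>n. dev j)\<bar> \<le> 1 / real n"
    by (intro eventually_mono[OF eventually_ge_at_top[of n]])
       (smt (verit) divide_nonneg_nonneg of_nat_0_le_iff)
  moreover have "(\<lambda>m. \<bar>(\<Sum>j\<le>m. dev j) - (\<Sum>j\<le>n. dev j)\<bar>) \<longlonglongrightarrow> \<bar>0 - (\<Sum>j\<le>n. dev j)\<bar>"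
    by (intro tendsto_intros sum_dev_LIMSEQ)
  ultimately show ?thesis
    using tendsto_upperbound[of _ "\<bar>0 - (\<Sum>j\<le>n. dev j)\<bar>" sequentially "1 / real n"] by simp
qed

lemma abs_dev_0_le: "\<bar>dev 0\<bar> \<le> 2"
  using abs_sum_dev_le[of 1] abs_dev_le[of 1] by (simp add: atMost_Suc)

text \<open>The coefficients of \<open>(1 - z) powr (- x)\<close> as a power series in \<open>z\<close>.\<close>

definition pker :: "nat \<Rightarrow> real \<Rightarrow> real" where
  "pker n x = pochhammer x n / fact n"

lemma pker_0 [simp]: "pker 0 x = 1" by (simp add: pker_def)

lemma pker_Suc: "pker (Suc n) x = pker n x * ((real n + x) / (real n + 1))"
  by (simp add: pker_def pochhammer_Suc field_simps)

lemma pker_nonneg: "x \<ge> 0 \<Longrightarrow> pker n x \<ge> 0"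
  by (induction n) (auto simp: pker_Suc)

lemma pker_at_0: "pker n 0 = (if n = 0 then 1 else 0)"
  by (simp add: pker_def pochhammer_0_left)

lemma continuous_on_pker [continuous_intros]: "continuous_on A (pker n)"
  unfolding pker_def pochhammer_prod by (intro continuous_intros) auto

text \<open>Both \<open>d/dx (1 - z) powr (- x)\<close> and \<open>ln (1 / (1 - z)) * (1 - z) powr (- x)\<close> have coefficients that satisfy
  this first-order recursion.\<close>

lemma sum_pker:
  "real (Suc n) * (\<Sum>j=1..Suc n. pker (Suc n - j) x / real j) =
     (real n + x) * (\<Sum>j=1..n. pker (n - j) x / real j) + pker n x"
proof -
  have rec: "real (Suc i) * pker (Suc i) x = (real i + x) * pker i x" for i
    by (simp add: pker_Suc field_simps)
  have "real (Suc n) * (\<Sum>j=1..Suc n. pker (Suc n - j) x / real j) =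
     (\<Sum>j=1..Suc n. real (Suc n - j) * pker (Suc n - j) x / real j + pker (Suc n - j) x)"
    unfolding sum_distrib_left
    by (intro sum.cong refl) (auto simp: field_simps of_nat_diff)
  also have "\<dots> = (\<Sum>j=1..Suc n. real (Suc n - j) * pker (Suc n - j) x / real j) + (\<Sum>j=1..Suc n. pker (Suc n - j) x)"
    by (rule sum.distrib)
  also have "(\<Sum>j=1..Suc n. real (Suc n - j) * pker (Suc n - j) x / real j) =
     (\<Sum>j=1..n. real (Suc n - j) * pker (Suc n - j) x / real j)"
    by simp
  also have "\<dots> = (\<Sum>j=1..n. (real (n - j) + x) * pker (n - j) x / real j)"
  proof (intro sum.cong refl)
    fix j assume "j \<in> {1..n}"
    then have "Suc n - j = Suc (n - j)" by auto
    then show "real (Suc n - j) * pker (Suc n - j) x / real j = (real (n - j) + x) * pker (n - j) x / real j"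
      by (simp only: rec)
  qed
  also have "\<dots> = (\<Sum>j=1..n. (real n + x) * (pker (n - j) x / real j) - pker (n - j) x)"
    by (intro sum.cong refl) (auto simp: field_simps of_nat_diff)
  also have "\<dots> = (real n + x) * (\<Sum>j=1..n. pker (n - j) x / real j) - (\<Sum>j=1..n. pker (n - j) x)"
    by (simp add: sum_subtractf sum_distrib_left)
  also have "(\<Sum>j=1..n. pker (n - j) x) = (\<Sum>i<n. pker i x)"
    by (rule sum.reindex_bij_witness[of _ "\<lambda>i. n - i" "\<lambda>i. n - i"]) auto
  also have "(\<Sum>j=1..Suc n. pker (Suc n - j) x) = (\<Sum>i<Suc n. pker i x)"
    by (rule sum.reindex_bij_witness[of _ "\<lambda>i. Suc n - i" "\<lambda>i. Suc n - i"]) auto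
  finally show ?thesis by simp
qed

lemma pker_has_derivative:
  "(pker n has_real_derivative (\<Sum>j=1..n. pker (n - j) x / real j)) (at x)"
proof (induction n)
  case 0
  have "pker 0 = (\<lambda>_. 1)" by auto
  then show ?case by simp
next
  case (Suc n)
  have "pker (Suc n) = (\<lambda>x. pker n x * ((real n + x) / (real n + 1)))"
    by (simp add: pker_Suc fun_eq_iff)
  moreover have "((\<lambda>x. pker n x * ((real n + x) / (real n + 1))) has_real_derivative
     ((\<Sum>j=1..n. pker (n - j) x / real j) * ((real n + x) / (real n + 1)) + pker n x * (1 / (real n + 1)))) (at x)"
    by (rule derivative_eq_intros Suc refl | simp)+
  moreover have "(\<Sum>j=1..n. pker (n - j) x / real j) * ((real n + x) / (real n + 1)) + pker n x * (1 / (real n + 1)) =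
     (\<Sum>j=1..Suc n. pker (Suc n - j) x / real j)"
  proof -
    have "(\<Sum>j=1..Suc n. pker (Suc n - j) x / real j) =
       ((real n + x) * (\<Sum>j=1..n. pker (n - j) x / real j) + pker n x) / real (Suc n)"
      unfolding sum_pker[symmetric] by (simp del: sum.cl_ivl_Suc)
    also have "\<dots> = (\<Sum>j=1..n. pker (n - j) x / real j) * ((real n + x) / (real n + 1)) + pker n x * (1 / (real n + 1))"
      by (simp add: add_divide_distrib[symmetric] mult.commute add.commute)
    finally show ?thesis by simp
  qed
  ultimately show ?case by (simp only:)
qed

lemma prod_one_plus_le:
  assumes x: "x \<ge> 0" and K: "K \<ge> 1"
  shows "(\<Prod>j=1..n. 1 + x / real j) \<le> (1 + x) ^ K * exp (x * max 0 (ln (real n / real K)))"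
proof (cases "n \<le> K")
  case True
  have "(\<Prod>j=1..n. 1 + x / real j) \<le> (\<Prod>j=1..n. 1 + x)"
    using x by (intro prod_mono) (auto simp: divide_le_eq mult_le_cancel_left1)
  also have "\<dots> = (1 + x) ^ n" by simp
  also have "\<dots> \<le> (1 + x) ^ K" using True x by (intro power_increasing) auto
  also have "\<dots> \<le> (1 + x) ^ K * exp (x * max 0 (ln (real n / real K)))"
    using x by (simp add: mult_le_cancel_left1)
  finally show ?thesis .
next
  case False
  then have "n \<ge> K" by simp
  then have "(\<Prod>j=1..n. 1 + x / real j) \<le> (1 + x) ^ K * exp (x * ln (real n / real K))"
  proof (induction n rule: dec_induct)
    case base
    have "(\<Prod>j=1..K. 1 + x / real j) \<le> (\<Prod>j=1..K. 1 + x)"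
      using x by (intro prod_mono) (auto simp: divide_le_eq mult_le_cancel_left1)
    then show ?case using K by simp
  next
    case (step n)
    have n: "real n \<ge> 1" using step K by simp
    have "1 / (real n + 1) \<le> ln ((real n + 1) / real n)"
      using ln_le_minus_one[of "real n / (real n + 1)"] n
      by (simp add: ln_div field_simps)
    then have "x * (1 / (real n + 1)) \<le> x * ln ((real n + 1) / real n)"
      using x by (rule mult_left_mono)
    then have "1 + x / (real n + 1) \<le> exp (x * ln ((real n + 1) / real n))"
      by (intro order_trans[OF _ exp_ge_add_one_self]) simp
    then have "(\<Prod>j=1..n. 1 + x / real j) * (1 + x / (real n + 1)) \<le>
        ((1 + x) ^ K * exp (x * ln (real n / real K))) * exp (x * ln ((real n + 1) / real n))"
      using x step.IH by (intro mult_mono) auto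
    also have "\<dots> = (1 + x) ^ K * exp (x * ln (real (Suc n) / real K))"
      using n K by (simp add: exp_add[symmetric] ln_div algebra_simps)
    finally show ?case by (simp add: add_ac)
  qed
  moreover have "ln (real n / real K) \<ge> 0" using \<open>n \<ge> K\<close> K by (simp add: ln_div)
  ultimately show ?thesis by (simp add: max_def)
qed

lemma pker_Suc_prod: "pker (Suc n) x = x / (real n + 1) * (\<Prod>j=1..n. 1 + x / real j)"
proof (induction n)
  case (Suc n)
  have "pker (Suc (Suc n)) x = pker (Suc n) x * ((real n + 1 + x) / (real n + 2))"
    by (simp add: pker_Suc[of "Suc n"] add_ac)
  then show ?case unfolding Suc by (simp add: field_simps)
qed (simp add: pker_Suc)

section \<open>The explicitly solvable renewal equation\<close>

lemma integral_exp_Ioi: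
  fixes c :: real
  assumes c: "c > 0"
  shows "set_integrable lborel {0<..} (\<lambda>x. exp (- (c * x)))"
    and "(LINT x:{0<..}|lborel. exp (- (c * x))) = 1 / c"
proof -
  have deriv: "DERIV (\<lambda>x. - exp (- (c * x)) / c) x :> exp (- (c * x))" for x
    using c by (auto intro!: derivative_eq_intros)
  have lim0: "(((\<lambda>x. - exp (- (c * x)) / c) \<circ> real_of_ereal) \<longlongrightarrow> - (1 / c)) (at_right 0)"
    unfolding zero_ereal_def ereal_tendsto_simps using c by (auto intro!: tendsto_eq_intros)
  have lim: "(((\<lambda>x. - exp (- (c * x)) / c) \<circ> real_of_ereal) \<longlongrightarrow> 0) (at_left \<infinity>)"
    unfolding ereal_tendsto_simps using c by real_asymp
  have nonneg: "AE x in lborel. 0 < ereal x \<longrightarrow> ereal x < \<infinity> \<longrightarrow> 0 \<le> exp (- (c * x))"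
    by (auto simp: zero_ereal_def)
  note * = interval_integral_FTC_nonneg[OF _ deriv _ nonneg lim0 lim]
  have e: "einterval 0 \<infinity> = {0<..}" by (auto simp: einterval_def zero_ereal_def)
  show "set_integrable lborel {0<..} (\<lambda>x. exp (- (c * x)))" using *(1) e by (simp add: zero_ereal_def[symmetric])
  show "(LINT x:{0<..}|lborel. exp (- (c * x))) = 1 / c"
    using *(2) by (simp add: interval_lebesgue_integral_def e zero_ereal_def[symmetric])
qed

lemma integral_x_exp_Ioi:
  fixes c :: real
  assumes c: "c > 0"
  shows "set_integrable lborel {0<..} (\<lambda>x. x * exp (- (c * x)))"
    and "(LINT x:{0<..}|lborel. x * exp (- (c * x))) = 1 / c\<^sup>2"
proof -
  have deriv: "DERIV (\<lambda>x. - (x / c + 1 / c\<^sup>2) * exp (- (c * x))) x :> x * exp (- (c * x))" for x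
    using c by (auto intro!: derivative_eq_intros simp: field_simps power2_eq_square)
  have lim0: "(((\<lambda>x. - (x / c + 1 / c\<^sup>2) * exp (- (c * x))) \<circ> real_of_ereal) \<longlongrightarrow> - (1 / c\<^sup>2)) (at_right 0)"
    unfolding zero_ereal_def ereal_tendsto_simps using c by (auto intro!: tendsto_eq_intros)
  have lim: "(((\<lambda>x. - (x / c + 1 / c\<^sup>2) * exp (- (c * x))) \<circ> real_of_ereal) \<longlongrightarrow> 0) (at_left \<infinity>)"
    unfolding ereal_tendsto_simps using c by real_asymp
  have nonneg: "AE x in lborel. 0 < ereal x \<longrightarrow> ereal x < \<infinity> \<longrightarrow> 0 \<le> x * exp (- (c * x))"
    by (auto simp: zero_ereal_def)
  note * = interval_integral_FTC_nonneg[OF _ deriv _ nonneg lim0 lim]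
  have e: "einterval 0 \<infinity> = {0<..}" by (auto simp: einterval_def zero_ereal_def)
  show "set_integrable lborel {0<..} (\<lambda>x. x * exp (- (c * x)))" using *(1) e by (simp add: zero_ereal_def[symmetric])
  show "(LINT x:{0<..}|lborel. x * exp (- (c * x))) = 1 / c\<^sup>2"
    using *(2) by (simp add: interval_lebesgue_integral_def e zero_ereal_def[symmetric])
qed

lemma one_plus_le_exp:
  fixes d x :: real
  assumes "d > 0" "x \<ge> 0"
  shows "1 + x \<le> max 1 (1 / d) * exp (d * x)"
proof -
  have "1 + x \<le> max 1 (1 / d) * 1 + max 1 (1 / d) * (d * x)"
  proof (rule add_mono)
    have "x = 1 / d * (d * x)" using assms by simp
    also have "\<dots> \<le> max 1 (1 / d) * (d * x)" using assms by (intro mult_right_mono) auto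
    finally show "x \<le> max 1 (1 / d) * (d * x)" .
  qed simp
  also have "\<dots> = max 1 (1 / d) * (1 + d * x)" by (simp add: distrib_left)
  also have "\<dots> \<le> max 1 (1 / d) * exp (d * x)" by (intro mult_left_mono) auto
  finally show ?thesis .
qed

lemma one_plus_power_le_exp:
  fixes d :: real
  assumes d: "d > 0"
  shows "\<exists>C\<ge>1. \<forall>x\<ge>0. (1 + x) ^ K \<le> C * exp (d * x)"
proof (intro exI[of _ "max 1 (1 / (d / (K + 1))) ^ K"] conjI allI impI)
  fix x :: real assume x: "x \<ge> 0"
  define e where "e = d / (real K + 1)"
  have e: "e > 0" "e * real K \<le> d" using d by (simp_all add: e_def field_simps)
  have "(1 + x) ^ K \<le> (max 1 (1 / e) * exp (e * x)) ^ K"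
    using x by (intro power_mono one_plus_le_exp e) auto
  also have "\<dots> = max 1 (1 / e) ^ K * exp (e * real K * x)"
    by (simp add: power_mult_distrib exp_of_nat_mult[symmetric] mult_ac)
  also have "\<dots> \<le> max 1 (1 / e) ^ K * exp (d * x)"
    using e x by (intro mult_left_mono) (auto intro: mult_right_mono)
  finally show "(1 + x) ^ K \<le> max 1 (1 / (d / (K + 1))) ^ K * exp (d * x)"
    by (simp add: e_def add_ac)
qed (simp add: one_le_power)

lemma pker_le_power: "x \<ge> 0 \<Longrightarrow> pker n x \<le> (1 + x) ^ n"
proof (induction n)
  case (Suc n)
  have "pker (Suc n) x \<le> (1 + x) ^ n * (1 + x)"
    unfolding pker_Suc using Suc
    by (intro mult_mono) (auto simp: divide_le_eq algebra_simps)
  then show ?case by (simp add: mult_ac)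
qed simp

lemma pker_measurable [measurable]: "pker n \<in> borel_measurable borel"
  by (intro borel_measurable_continuous_onI continuous_on_pker)

lemma pker_integrable:
  assumes k: "k > 0"
  shows "set_integrable lborel {0<..} (\<lambda>x. exp (- (k * x)) * pker n x)"
proof -
  obtain C where C: "C \<ge> 1" "\<And>x. x \<ge> 0 \<Longrightarrow> (1 + x) ^ n \<le> C * exp (k / 2 * x)"
    using one_plus_power_le_exp[of "k / 2" n] k by auto
  show ?thesis
  proof (rule set_integrable_bound[of _ _ "\<lambda>x. C * exp (- (k / 2 * x))"])
    show "set_integrable lborel {0<..} (\<lambda>x. C * exp (- (k / 2 * x)))"
      using integral_exp_Ioi(1)[of "k / 2"] k by simp
    show "AE x in lborel. x \<in> {0<..} \<longrightarrow> norm (exp (- (k * x)) * pker n x) \<le> norm (C * exp (- (k / 2 * x)))"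
    proof (intro AE_I2 impI)
      fix x :: real assume "x \<in> {0<..}"
      then have x: "x \<ge> 0" by simp
      have "exp (- (k * x)) * pker n x \<le> exp (- (k * x)) * (C * exp (k / 2 * x))"
        using order_trans[OF pker_le_power C(2)] x by (intro mult_left_mono) auto
      also have "\<dots> = C * (exp (- (k * x)) * exp (k / 2 * x))" by simp
      also have "exp (- (k * x)) * exp (k / 2 * x) = exp (- (k / 2 * x))"
        by (simp add: exp_add[symmetric])
      finally show "norm (exp (- (k * x)) * pker n x) \<le> norm (C * exp (- (k / 2 * x)))"
        using x C(1) pker_nonneg[of x n] by simp
    qed
  qed (simp add: set_borel_measurable_def)
qed

text \<open>Integrating \<open>exp (- k x) (1 - z) powr (- x)\<close> over \<open>x\<close> gives \<open>1 / (k - ln (1 / (1 - z)))\<close>, formally; the next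
  definition is its \<open>n\<close>-th coefficient.\<close>

definition vren :: "real \<Rightarrow> nat \<Rightarrow> real" where
  "vren k n = (LINT x:{0<..}|lborel. exp (- (k * x)) * pker n x)"

lemma vren_0: "k > 0 \<Longrightarrow> vren k 0 = 1 / k"
  by (simp add: vren_def integral_exp_Ioi)

lemma vren_renewal:
  assumes k: "k > 0"
  shows "k * vren k n = (if n = 0 then 1 else 0) + (\<Sum>j=1..n. vren k (n - j) / real j)"
proof -
  define d where "d x = (\<Sum>j=1..n. pker (n - j) x / real j)" for x
  define F where "F x = - (exp (- (k * x)) * pker n x)" for x
  define f where "f x = k * (exp (- (k * x)) * pker n x) - exp (- (k * x)) * d x" for x
  have e: "einterval 0 \<infinity> = {0<..}" by (auto simp: einterval_def zero_ereal_def)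
  have dd: "exp (- (k * x)) * d x = (\<Sum>j=1..n. exp (- (k * x)) * pker (n - j) x / real j)" for x
    by (simp add: d_def sum_distrib_left)
  have int_d: "set_integrable lborel {0<..} (\<lambda>x. exp (- (k * x)) * d x)"
    unfolding dd set_integrable_def scaleR_sum_right
    by (intro Bochner_Integration.integrable_sum) (use pker_integrable[OF k] in \<open>auto simp: set_integrable_def\<close>)
  have int_f: "set_integrable lborel {0<..} f"
    unfolding f_def[abs_def] by (intro set_integral_diff int_d set_integrable_mult_right pker_integrable k)
  have cont: "continuous_on UNIV f"
    unfolding f_def[abs_def] d_def by (intro continuous_intros) auto
  obtain C where C: "C \<ge> 1" "\<And>x. x \<ge> 0 \<Longrightarrow> (1 + x) ^ n \<le> C * exp (k / 2 * x)"
    using one_plus_power_le_exp[of "k / 2" n] k by auto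
  have "(LBINT x=0..\<infinity>. f x) = 0 - (- pker n 0)"
  proof (rule interval_integral_FTC_integrable[where F = F])
    fix x
    have "(F has_real_derivative f x) (at x)"
      unfolding F_def f_def d_def
      by (rule derivative_eq_intros pker_has_derivative refl | simp)+
    then show "(F has_vector_derivative f x) (at x)"
      by (simp add: has_real_derivative_iff_has_vector_derivative)
    show "isCont f x" using cont by (simp add: continuous_on_eq_continuous_at)
  next
    show "set_integrable lborel (einterval 0 \<infinity>) f" using int_f by (simp add: e)
    have "isCont (pker n) 0" using continuous_on_pker[of UNIV n] by (simp add: continuous_on_eq_continuous_at)
    then have "isCont F 0" unfolding F_def by (intro continuous_intros)
    then have "(F \<longlongrightarrow> F 0) (at_right 0)"
      by (meson isContD tendsto_within_subset top_greatest)
    then show "((F \<circ> real_of_ereal) \<longlongrightarrow> - pker n 0) (at_right 0)"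
      unfolding zero_ereal_def ereal_tendsto_simps by (simp add: F_def)
    have "(F \<longlongrightarrow> 0) at_top"
    proof (rule Lim_null_comparison)
      show "\<forall>\<^sub>F x in at_top. norm (F x) \<le> C * exp (- (k / 2 * x))"
        using eventually_ge_at_top[of 0]
      proof eventually_elim
        case (elim x)
        have "exp (- (k * x)) * pker n x \<le> exp (- (k * x)) * (C * exp (k / 2 * x))"
          using order_trans[OF pker_le_power C(2)] elim by (intro mult_left_mono) auto
        also have "\<dots> = C * (exp (- (k * x)) * exp (k / 2 * x))" by simp
        also have "exp (- (k * x)) * exp (k / 2 * x) = exp (- (k / 2 * x))"
          by (simp add: exp_add[symmetric])
        finally show ?case using pker_nonneg[OF elim, of n] by (simp add: F_def)
      qed
      show "((\<lambda>x. C * exp (- (k / 2 * x))) \<longlongrightarrow> 0) at_top" using k by real_asymp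
    qed
    then show "((F \<circ> real_of_ereal) \<longlongrightarrow> 0) (at_left \<infinity>)"
      unfolding ereal_tendsto_simps .
  qed simp
  then have "(LINT x:{0<..}|lborel. f x) = pker n 0"
    by (simp add: interval_lebesgue_integral_def e)
  moreover have "(LINT x:{0<..}|lborel. f x) = k * vren k n - (LINT x:{0<..}|lborel. exp (- (k * x)) * d x)"
    unfolding f_def vren_def
    by (subst set_integral_diff) (auto intro!: int_d set_integrable_mult_right pker_integrable k)
  moreover have "(LINT x:{0<..}|lborel. exp (- (k * x)) * d x) = (\<Sum>j=1..n. vren k (n - j) / real j)"
    unfolding dd vren_def set_lebesgue_integral_def scaleR_sum_right
    by (subst Bochner_Integration.integral_sum) (use pker_integrable[OF k] in \<open>auto simp: set_integrable_def\<close>)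
  ultimately show ?thesis by (simp add: pker_at_0)
qed

definition ell :: "nat \<Rightarrow> nat \<Rightarrow> real" where
  "ell N n = 1 + ln (real N / real n)"

lemma ell_ge_1: "1 \<le> n \<Longrightarrow> n \<le> N \<Longrightarrow> ell N n \<ge> 1"
  by (simp add: ell_def)

lemma ell_antimono: "1 \<le> m \<Longrightarrow> m \<le> n \<Longrightarrow> n \<le> N \<Longrightarrow> ell N n \<le> ell N m"
  by (simp add: ell_def ln_div)

lemma pker_bound:
  fixes c :: real
  assumes c: "c \<ge> 0"
  shows "\<exists>C>0. \<forall>N k n x. 2 * c + 1 \<le> ln (real N) \<longrightarrow> ln (real N) - c \<le> k \<longrightarrow> 1 \<le> n \<longrightarrow> n \<le> N \<longrightarrow> 0 \<le> x \<longrightarrow>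
     exp (- (k * x)) * pker n x \<le> C / real n * (x * exp (- (ell N n / 4 * x)))"
proof -
  define K where "K = nat \<lceil>exp (c + 1)\<rceil>"
  have "real K \<ge> exp (c + 1)" by (simp add: K_def)
  then have K: "K \<ge> 1" "ln (real K) \<ge> c + 1"
    using ln_mono[of "exp (c + 1)" "real K"] less_le_trans[OF exp_gt_zero, of "c + 1" "real K"] by auto
  obtain C where C: "C \<ge> 1" "\<And>x. x \<ge> 0 \<Longrightarrow> (1 + x) ^ K \<le> C * exp (1 / 4 * (x::real))"
    using one_plus_power_le_exp[of "1 / 4" K] by auto
  show ?thesis
  proof (intro exI[of _ C] conjI allI impI)
    fix N n :: nat and k x :: real
    assume N: "2 * c + 1 \<le> ln (real N)" and k: "ln (real N) - c \<le> k" and n: "1 \<le> n" "n \<le> N" and x: "0 \<le> x"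
    define m where "m = max 0 (ln (real n / real K))"
    have ell: "ell N n / 2 + m \<le> k"
    proof (cases "K \<le> n")
      case True
      then have "m = ln (real n) - ln (real K)" using K n by (simp add: m_def ln_div)
      then have "ell N n + m \<le> k" using k n K by (simp add: ell_def ln_div)
      then show ?thesis using ell_ge_1[OF n] by simp
    next
      case False
      then have "m = 0" using K n by (simp add: m_def ln_div max_def)
      moreover have "ln (real n) \<ge> 0" using n by simp
      moreover have "ell N n = 1 + (ln (real N) - ln (real n))" using n by (simp add: ell_def ln_div)
      ultimately show ?thesis using k N by linarith
    qed
    have "exp (- (k * x)) * pker n x = exp (- (k * x)) * (x / real n * (\<Prod>j=1..n-1. 1 + x / real j))"
      using n pker_Suc_prod[of "n - 1" x] by simp
    also have "\<dots> \<le> exp (- (k * x)) * (x / real n * ((C * exp (1 / 4 * x)) * exp (x * m)))"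
    proof (intro mult_left_mono)
      have "(\<Prod>j=1..n-1. 1 + x / real j) \<le> (\<Prod>j=1..n. 1 + x / real j)"
        using x n by (intro prod_mono2) auto
      also have "\<dots> \<le> (1 + x) ^ K * exp (x * m)"
        unfolding m_def by (rule prod_one_plus_le[OF x K(1)])
      also have "\<dots> \<le> (C * exp (1 / 4 * x)) * exp (x * m)"
        using C(2)[OF x] by (intro mult_right_mono) auto
      finally show "(\<Prod>j=1..n-1. 1 + x / real j) \<le> (C * exp (1 / 4 * x)) * exp (x * m)" .
    qed (use x in auto)
    also have "\<dots> = C / real n * (x * exp (- (k * x) + 1 / 4 * x + x * m))"
      unfolding exp_add by (simp add: mult_ac)
    also have "\<dots> \<le> C / real n * (x * exp (- (ell N n / 4 * x)))"
    proof -
      have "x * (ell N n / 4 + 1 / 4 + m) \<le> x * k"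
        using x ell ell_ge_1[OF n] by (intro mult_left_mono) auto
      then have "- (k * x) + 1 / 4 * x + x * m \<le> - (ell N n / 4 * x)" by (simp add: algebra_simps)
      then show ?thesis using x C by (intro mult_left_mono) auto
    qed
    finally show "exp (- (k * x)) * pker n x \<le> C / real n * (x * exp (- (ell N n / 4 * x)))" .
  qed (use C in auto)
qed

lemma vren_nonneg: "vren k n \<ge> 0"
  unfolding vren_def set_lebesgue_integral_def
  by (rule integral_nonneg_AE) (auto simp: pker_nonneg indicator_def)

lemma vren_bounds:
  fixes c :: real
  assumes c: "c \<ge> 0"
  shows "\<exists>C>0. \<forall>N k. 2 * c + 1 \<le> ln (real N) \<longrightarrow> ln (real N) - c \<le> k \<longrightarrow>
     vren k 0 \<le> C / (1 + ln (real N)) \<and>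
     (\<forall>n. 1 \<le> n \<longrightarrow> n \<le> N \<longrightarrow> vren k n \<le> C / (real n * (ell N n)\<^sup>2)) \<and>
     (\<forall>n. 2 \<le> n \<longrightarrow> n \<le> N \<longrightarrow> \<bar>vren k n - vren k (n - 1)\<bar> \<le> C / ((real n)\<^sup>2 * (ell N n)\<^sup>2))"
proof -
  obtain C where C: "C > 0" and bound: "\<And>N k n x. 2 * c + 1 \<le> ln (real N) \<Longrightarrow> ln (real N) - c \<le> k \<Longrightarrow>
     1 \<le> n \<Longrightarrow> n \<le> N \<Longrightarrow> 0 \<le> x \<Longrightarrow> exp (- (k * x)) * pker n x \<le> C / real n * (x * exp (- (ell N n / 4 * x)))"
    using pker_bound[OF c] by blast
  show ?thesis
  proof (intro exI[of _ "1024 * C + 2"] conjI allI impI)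
    fix N :: nat and k :: real
    assume N: "2 * c + 1 \<le> ln (real N)" and k: "ln (real N) - c \<le> k"
    have k0: "k > 0" "k \<ge> (1 + ln (real N)) / 2" using N k c by auto
    have "vren k 0 = 1 / k" using k0 by (simp add: vren_0)
    also have "\<dots> \<le> 1 / ((1 + ln (real N)) / 2)" using k0 N c by (intro divide_left_mono) auto
    also have "\<dots> \<le> (1024 * C + 2) / (1 + ln (real N))" using N c C by (simp add: divide_right_mono)
    finally show "vren k 0 \<le> (1024 * C + 2) / (1 + ln (real N))" .
    fix n assume nN: "n \<le> N"
    show "vren k n \<le> (1024 * C + 2) / (real n * (ell N n)\<^sup>2)" if "1 \<le> n"
    proof -
      have l: "ell N n > 0" using ell_ge_1[OF that nN] by simp
      have "vren k n \<le> (LINT x:{0<..}|lborel. C / real n * (x * exp (- (ell N n / 4 * x))))"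
        unfolding vren_def using l
        by (intro set_integral_mono pker_integrable k0 set_integrable_mult_right integral_x_exp_Ioi)
           (use bound[OF N k that nN] in auto)
      also have "\<dots> = C / real n * (1 / (ell N n / 4)\<^sup>2)"
        using integral_x_exp_Ioi(2)[of "ell N n / 4"] l by simp
      also have "\<dots> = 16 * C / (real n * (ell N n)\<^sup>2)" by (simp add: power_divide)
      also have "\<dots> \<le> (1024 * C + 2) / (real n * (ell N n)\<^sup>2)"
        using C by (intro divide_right_mono) auto
      finally show ?thesis .
    qed
    show "\<bar>vren k n - vren k (n - 1)\<bar> \<le> (1024 * C + 2) / ((real n)\<^sup>2 * (ell N n)\<^sup>2)" if n: "2 \<le> n"
    proof -
      have l: "ell N n \<ge> 1" using ell_ge_1[of n N] n nN by simp
      let ?D = "\<lambda>x. exp (- (k * x)) * pker n x - exp (- (k * x)) * pker (n - 1) x"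
      have int: "set_integrable lborel {0<..} ?D"
        by (intro set_integral_diff pker_integrable k0)
      have "\<bar>vren k n - vren k (n - 1)\<bar> = norm (LINT x:{0<..}|lborel. ?D x)"
        unfolding vren_def by (subst set_integral_diff(2)) (auto intro!: pker_integrable k0)
      also have "\<dots> \<le> (LINT x:{0<..}|lborel. norm (?D x))"
        by (rule set_integral_norm_bound[OF int])
      also have "\<dots> \<le> (LINT x:{0<..}|lborel. 16 * C / (real n)\<^sup>2 * (x * exp (- (ell N n / 8 * x))))"
      proof (rule set_integral_mono)
        show "set_integrable lborel {0<..} (\<lambda>x. norm (?D x))"
          using int by (rule set_integrable_norm)
        show "set_integrable lborel {0<..} (\<lambda>x. 16 * C / (real n)\<^sup>2 * (x * exp (- (ell N n / 8 * x))))"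
          using l by (intro set_integrable_mult_right integral_x_exp_Ioi) auto
        fix x :: real assume "x \<in> {0<..}"
        then have x: "x > 0" by simp
        have "pker n x = pker (n - 1) x * ((real n - 1 + x) / real n)"
          using pker_Suc[of "n - 1" x] n by (simp add: of_nat_diff)
        then have p1: "pker (n - 1) x = pker n x * (real n / (real n - 1 + x))"
          using n x by (simp add: field_simps)
        have 1: "norm (?D x) = exp (- (k * x)) * pker n x * \<bar>1 - real n / (real n - 1 + x)\<bar>"
        proof -
          have "?D x = exp (- (k * x)) * pker n x * (1 - real n / (real n - 1 + x))"
            unfolding p1 by (simp add: algebra_simps)
          then show ?thesis using pker_nonneg[of x n] x by (simp add: abs_mult)
        qed
        have 2: "\<bar>1 - real n / (real n - 1 + x)\<bar> \<le> 2 / real n * (8 * exp (ell N n / 8 * x))"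
        proof -
          have "1 - real n / (real n - 1 + x) = (x - 1) / (real n - 1 + x)"
            using n x by (simp add: field_simps)
          then have "\<bar>1 - real n / (real n - 1 + x)\<bar> = \<bar>x - 1\<bar> / (real n - 1 + x)"
            using n x by simp
          also have "\<dots> \<le> (1 + x) / (real n / 2)"
            using n x by (intro frac_le) auto
          also have "\<dots> = 2 / real n * (1 + x)" by simp
          also have "\<dots> \<le> 2 / real n * (8 * exp (ell N n / 8 * x))"
          proof (intro mult_left_mono)
            have "1 + x \<le> 8 * exp (1 / 8 * x)" using one_plus_le_exp[of "1/8" x] x by simp
            also have "\<dots> \<le> 8 * exp (ell N n / 8 * x)" using x l by simp
            finally show "1 + x \<le> 8 * exp (ell N n / 8 * x)" .
          qed simp
          finally show ?thesis .
        qed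
        have 3: "exp (- (k * x)) * pker n x \<le> C / real n * (x * exp (- (ell N n / 4 * x)))"
          using n nN x by (intro bound N k) auto
        have "norm (?D x) \<le> C / real n * (x * exp (- (ell N n / 4 * x))) * (2 / real n * (8 * exp (ell N n / 8 * x)))"
          unfolding 1 using x C by (intro mult_mono 2 3) auto
        also have "C / real n * (x * exp (- (ell N n / 4 * x))) * (2 / real n * (8 * exp (ell N n / 8 * x))) =
            16 * C / (real n)\<^sup>2 * (x * (exp (- (ell N n / 4 * x)) * exp (ell N n / 8 * x)))"
          by (simp add: power2_eq_square)
        also have "exp (- (ell N n / 4 * x)) * exp (ell N n / 8 * x) = exp (- (ell N n / 8 * x))"
          by (simp add: exp_add[symmetric])
        finally show "norm (?D x) \<le> 16 * C / (real n)\<^sup>2 * (x * exp (- (ell N n / 8 * x)))" .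
      qed
      also have "\<dots> = 16 * C / (real n)\<^sup>2 * (1 / (ell N n / 8)\<^sup>2)"
        using integral_x_exp_Ioi(2)[of "ell N n / 8"] l by simp
      also have "\<dots> = 1024 * C / ((real n)\<^sup>2 * (ell N n)\<^sup>2)" by (simp add: power_divide)
      also have "\<dots> \<le> (1024 * C + 2) / ((real n)\<^sup>2 * (ell N n)\<^sup>2)"
        by (intro divide_right_mono) auto
      finally show ?thesis .
    qed
  qed (use C in auto)
qed

section \<open>Perturbation of the renewal equation\<close>

lemma one_plus_ln_le:
  assumes "n \<ge> 1"
  shows "1 + ln (real n) \<le> 2 * sqrt (real n)" "(1 + ln (real n))\<^sup>2 \<le> 16 * sqrt (real n)"
proof -
  have n: "real n \<ge> 1" using assms by simp
  have "ln (sqrt (real n)) \<le> sqrt (real n) - 1" using n by (intro ln_le_minus_one) auto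
  then show "1 + ln (real n) \<le> 2 * sqrt (real n)" using n by (simp add: ln_sqrt)
  define q where "q = sqrt (sqrt (real n))"
  have q: "q \<ge> 1" using n by (simp add: q_def)
  have "ln q \<le> q - 1" using q by (intro ln_le_minus_one) auto
  moreover have "ln q = ln (real n) / 4" using n by (simp add: q_def ln_sqrt)
  ultimately have "1 + ln (real n) \<le> 4 * q" by simp
  then have "(1 + ln (real n))\<^sup>2 \<le> (4 * q)\<^sup>2" using n by (intro power_mono) auto
  also have "\<dots> = 16 * sqrt (real n)" using n by (simp add: q_def power_mult_distrib)
  finally show "(1 + ln (real n))\<^sup>2 \<le> 16 * sqrt (real n)" .
qed

lemma harm_le_one_plus_ln: "n \<ge> 1 \<Longrightarrow> (\<Sum>j=1..n. 1 / real j) \<le> 1 + ln (real n)"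
proof (induction n rule: dec_induct)
  case (step n)
  have n: "real n \<ge> 1" using step by simp
  have "1 / (real n + 1) \<le> ln (real n + 1) - ln (real n)"
    using ln_le_minus_one[of "real n / (real n + 1)"] n by (simp add: ln_div field_simps)
  then show ?case using step.IH by (simp add: add_ac)
qed simp

lemma inverse_ell_le:
  assumes n: "1 \<le> n" "n \<le> N"
  shows "1 / ell N n \<le> (1 + ln (real n)) / (1 + ln (real N))"
proof -
  have l: "ell N n \<ge> 1" by (rule ell_ge_1[OF n])
  have L: "ln (real n) \<ge> 0" "ln (real N) \<ge> 0" using n by auto
  have "1 + ln (real N) = ell N n + ln (real n)" using n by (simp add: ell_def ln_div)
  also have "\<dots> \<le> ell N n + ell N n * ln (real n)" using l L by (simp add: mult_le_cancel_right1)
  finally show ?thesis using l L by (simp add: divide_simps algebra_simps)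
qed

lemma inverse_ell_square_le:
  assumes n: "1 \<le> n" "n \<le> N"
  shows "1 / (ell N n)\<^sup>2 \<le> (1 + ln (real n)) / (1 + ln (real N))"
proof -
  have l: "ell N n \<ge> 1" by (rule ell_ge_1[OF n])
  have "1 / (ell N n)\<^sup>2 \<le> 1 / ell N n"
    using l by (intro divide_left_mono) (auto simp: power2_eq_square mult_le_cancel_left1)
  also note inverse_ell_le[OF n]
  finally show ?thesis .
qed

lemma ell_le: "1 \<le> n \<Longrightarrow> n \<le> N \<Longrightarrow> ell N n \<le> 1 + ln (real N)"
  by (simp add: ell_def ln_div)

text \<open>The order of magnitude of \<open>vren k n\<close> when \<open>k\<close> is close to \<open>ln N\<close>, and also of \<open>Gth th (n / N) / N\<close>.\<close>

definition decay :: "nat \<Rightarrow> nat \<Rightarrow> real" where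
  "decay N n = 1 / (real n * (ell N n)\<^sup>2)"

lemma decay_pos: "1 \<le> n \<Longrightarrow> n \<le> N \<Longrightarrow> decay N n > 0"
  using ell_ge_1[of n N] by (auto simp: decay_def)

lemma decay_le_double:
  assumes "1 \<le> m" "m \<le> n" "n \<le> N" "n \<le> 2 * m"
  shows "decay N m \<le> 2 * decay N n"
proof -
  have l: "1 \<le> ell N n" "ell N n \<le> ell N m" using assms ell_antimono ell_ge_1 by auto
  have "real n / 2 * (ell N n)\<^sup>2 \<le> real m * (ell N m)\<^sup>2"
    using assms l by (intro mult_mono power_mono) auto
  then have "1 / (real m * (ell N m)\<^sup>2) \<le> 1 / (real n / 2 * (ell N n)\<^sup>2)"
    using assms l by (intro divide_left_mono) auto
  then show ?thesis by (simp add: decay_def)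
qed

lemma sum_decay_le:
  assumes n: "1 \<le> n" "n \<le> N"
  shows "(\<Sum>i=1..n. decay N i) \<le> (1 + ln (real n)) / (ell N n)\<^sup>2"
proof -
  have l: "1 \<le> ell N n" using n ell_ge_1 by auto
  have "(\<Sum>i=1..n. decay N i) \<le> (\<Sum>i=1..n. 1 / real i / (ell N n)\<^sup>2)"
  proof (rule sum_mono)
    fix i assume i: "i \<in> {1..n}"
    then have "ell N n \<le> ell N i" using n ell_antimono by auto
    then show "decay N i \<le> 1 / real i / (ell N n)\<^sup>2"
      using i l by (simp add: decay_def divide_left_mono mult_left_mono power_mono)
  qed
  also have "\<dots> = (\<Sum>i=1..n. 1 / real i) / (ell N n)\<^sup>2" by (simp add: sum_divide_distrib)
  also have "\<dots> \<le> (1 + ln (real n)) / (ell N n)\<^sup>2"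
    using harm_le_one_plus_ln[OF n(1)] by (rule divide_right_mono) simp
  finally show ?thesis .
qed

lemma dev_conv_bound:
  fixes v :: "nat \<Rightarrow> real"
  assumes C: "C \<ge> 0"
    and v0: "\<bar>v 0\<bar> \<le> C / (1 + ln (real N))"
    and v: "\<And>n. 1 \<le> n \<Longrightarrow> n \<le> N \<Longrightarrow> \<bar>v n\<bar> \<le> C * decay N n"
    and dv: "\<And>n. 2 \<le> n \<Longrightarrow> n \<le> N \<Longrightarrow> \<bar>v n - v (n - 1)\<bar> \<le> C * decay N n / real n"
    and n: "1 \<le> n" "n \<le> N"
  shows "\<bar>\<Sum>j\<le>n. dev j * v (n - j)\<bar> \<le> 240 * C / ((1 + ln (real N)) * (real n * sqrt (real n)))"
proof -
  define \<Lambda> where "\<Lambda> = 1 + ln (real N)"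
  define q where "q = 1 + ln (real n)"
  define m where "m = n div 2"
  have rn: "real n \<ge> 1" using n by simp
  have \<Lambda>: "\<Lambda> \<ge> 1" using n by (simp add: \<Lambda>_def)
  have q: "q \<ge> 1" using n by (simp add: q_def)
  have qq: "q \<le> q\<^sup>2" using q by (simp add: power2_eq_square mult_le_cancel_left1)
  have l: "ell N n \<ge> 1" by (rule ell_ge_1[OF n])
  have il: "1 / (ell N n)\<^sup>2 \<le> q / \<Lambda>"
    unfolding q_def \<Lambda>_def by (rule inverse_ell_square_le[OF n])
  have decayL: "decay N n \<le> q / (\<Lambda> * real n)"
  proof -
    have "decay N n = 1 / (ell N n)\<^sup>2 / real n" by (simp add: decay_def)
    also have "\<dots> \<le> q / \<Lambda> / real n" using il by (rule divide_right_mono) simp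
    finally show ?thesis by simp
  qed
  have diff: "\<bar>v (n - j) - v n\<bar> \<le> real j * (4 * C * decay N n / real n)" if "j \<le> m" for j
    using that
  proof (induction j)
    case (Suc j)
    define i where "i = n - j"
    have i: "2 \<le> i" "i \<le> n" "n \<le> 2 * i" "n - Suc j = i - 1"
      using Suc.prems by (auto simp: i_def m_def)
    have "\<bar>v i - v (i - 1)\<bar> \<le> C * decay N i / real i" using i n by (intro dv) auto
    also have "\<dots> \<le> C * (2 * decay N n) / (real n / 2)"
      using i n C decay_pos[of i N] decay_le_double[of i n N]
      by (intro frac_le mult_left_mono mult_nonneg_nonneg) auto
    finally have "\<bar>v i - v (i - 1)\<bar> \<le> 4 * C * decay N n / real n" by (simp add: mult_ac)
    moreover have "\<bar>v i - v n\<bar> \<le> real j * (4 * C * decay N n / real n)"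
      using Suc by (simp add: i_def)
    moreover have "real (Suc j) * (4 * C * decay N n / real n) = 4 * C * decay N n / real n + real j * (4 * C * decay N n / real n)"
      by (simp add: distrib_right add_divide_distrib)
    ultimately show ?case unfolding i(4) by linarith
  qed simp
  have T1: "\<bar>\<Sum>j\<le>m. dev j * (v (n - j) - v n)\<bar> \<le> 4 * C * q\<^sup>2 / (\<Lambda> * (real n)\<^sup>2)"
  proof -
    have "\<bar>\<Sum>j\<le>m. dev j * (v (n - j) - v n)\<bar> = \<bar>\<Sum>j=1..m. dev j * (v (n - j) - v n)\<bar>"
      by (intro arg_cong[of _ _ abs] sum.mono_neutral_right) (auto simp: Suc_le_eq)
    also have "\<dots> \<le> (\<Sum>j=1..m. \<bar>dev j * (v (n - j) - v n)\<bar>)" by (rule sum_abs)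
    also have "\<dots> \<le> (\<Sum>j=1..m. (1 / real j) * (4 * C * decay N n / real n))"
    proof (rule sum_mono)
      fix j assume j: "j \<in> {1..m}"
      have "\<bar>dev j * (v (n - j) - v n)\<bar> \<le> 1 / (real j)\<^sup>2 * (real j * (4 * C * decay N n / real n))"
        unfolding abs_mult using j by (intro mult_mono abs_dev_le diff) auto
      also have "\<dots> = (1 / real j) * (4 * C * decay N n / real n)" using j by (simp add: power2_eq_square)
      finally show "\<bar>dev j * (v (n - j) - v n)\<bar> \<le> (1 / real j) * (4 * C * decay N n / real n)" .
    qed
    also have "\<dots> = (\<Sum>j=1..m. 1 / real j) * (4 * C * decay N n / real n)"
      by (simp only: sum_distrib_right)
    also have "\<dots> \<le> q * (4 * C * (q / (\<Lambda> * real n)) / real n)"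
    proof (rule mult_mono)
      have "(\<Sum>j=1..m. 1 / real j) \<le> (\<Sum>j=1..n. 1 / real j)"
        by (rule sum_mono2) (auto simp: m_def)
      then show "(\<Sum>j=1..m. 1 / real j) \<le> q" using harm_le_one_plus_ln[OF n(1)] by (simp add: q_def)
      show "4 * C * decay N n / real n \<le> 4 * C * (q / (\<Lambda> * real n)) / real n"
        using decayL C by (intro divide_right_mono mult_left_mono) auto
    qed (use q C decay_pos[OF n] in auto)
    also have "\<dots> = 4 * C * q\<^sup>2 / (\<Lambda> * (real n)\<^sup>2)" by (simp add: power2_eq_square mult_ac)
    finally show ?thesis .
  qed
  have T2: "\<bar>v n * (\<Sum>j\<le>m. dev j)\<bar> \<le> 3 * C * q\<^sup>2 / (\<Lambda> * (real n)\<^sup>2)"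
  proof -
    have "\<bar>\<Sum>j\<le>m. dev j\<bar> \<le> 3 / real n"
    proof (cases "n = 1")
      case True
      then show ?thesis using abs_dev_0_le by (simp add: m_def)
    next
      case False
      then have m: "m \<ge> 1" "n \<le> 3 * m" using n by (auto simp: m_def)
      have "\<bar>\<Sum>j\<le>m. dev j\<bar> \<le> 1 / real m" using m by (intro abs_sum_dev_le) auto
      also have "\<dots> \<le> 3 / real n" using m n by (simp add: divide_simps)
      finally show ?thesis .
    qed
    then have "\<bar>v n * (\<Sum>j\<le>m. dev j)\<bar> \<le> (C * (q / (\<Lambda> * real n))) * (3 / real n)"
      unfolding abs_mult using C q \<Lambda>
      by (intro mult_mono order_trans[OF v[OF n] mult_left_mono[OF decayL C]]) auto
    also have "\<dots> = 3 * C * q / (\<Lambda> * (real n)\<^sup>2)" by (simp add: power2_eq_square mult_ac)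
    also have "\<dots> \<le> 3 * C * q\<^sup>2 / (\<Lambda> * (real n)\<^sup>2)"
      using C \<Lambda> qq by (intro divide_right_mono mult_left_mono) auto
    finally show ?thesis .
  qed
  have T3: "\<bar>\<Sum>j\<in>{m<..n}. dev j * v (n - j)\<bar> \<le> 8 * C * q\<^sup>2 / (\<Lambda> * (real n)\<^sup>2)"
  proof -
    have "\<bar>\<Sum>j\<in>{m<..n}. dev j * v (n - j)\<bar> \<le> (\<Sum>j\<in>{m<..n}. \<bar>dev j * v (n - j)\<bar>)" by (rule sum_abs)
    also have "\<dots> \<le> (\<Sum>j\<in>{m<..n}. 4 / (real n)\<^sup>2 * \<bar>v (n - j)\<bar>)"
    proof (rule sum_mono)
      fix j assume j: "j \<in> {m<..n}"
      then have j': "1 \<le> j" "n \<le> 2 * j" by (auto simp: m_def)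
      have "\<bar>dev j\<bar> \<le> 1 / (real j)\<^sup>2" using j' by (intro abs_dev_le)
      also have "\<dots> \<le> 1 / (real n / 2)\<^sup>2"
        using j' n by (intro divide_left_mono power_mono) auto
      also have "\<dots> = 4 / (real n)\<^sup>2" by (simp add: power_divide)
      finally show "\<bar>dev j * v (n - j)\<bar> \<le> 4 / (real n)\<^sup>2 * \<bar>v (n - j)\<bar>"
        unfolding abs_mult by (rule mult_right_mono) simp
    qed
    also have "\<dots> = 4 / (real n)\<^sup>2 * (\<Sum>j\<in>{m<..n}. \<bar>v (n - j)\<bar>)" by (simp only: sum_distrib_left)
    also have "(\<Sum>j\<in>{m<..n}. \<bar>v (n - j)\<bar>) = (\<Sum>i<n-m. \<bar>v i\<bar>)"
      by (rule sum.reindex_bij_witness[of _ "\<lambda>i. n - i" "\<lambda>i. n - i"]) auto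
    also have "4 / (real n)\<^sup>2 * \<dots> \<le> 4 / (real n)\<^sup>2 * (2 * C * q\<^sup>2 / \<Lambda>)"
    proof (rule mult_left_mono)
      have "(\<Sum>i<n-m. \<bar>v i\<bar>) \<le> (\<Sum>i\<le>n. \<bar>v i\<bar>)" by (rule sum_mono2) auto
      also have "\<dots> = \<bar>v 0\<bar> + (\<Sum>i=1..n. \<bar>v i\<bar>)"
      proof -
        have "{..n} = insert 0 {1..n}" by auto
        then show ?thesis by simp
      qed
      also have "\<dots> \<le> C / \<Lambda> + (\<Sum>i=1..n. C * decay N i)"
        using v0 v n by (intro add_mono sum_mono) (auto simp: \<Lambda>_def)
      also have "(\<Sum>i=1..n. C * decay N i) = C * (\<Sum>i=1..n. decay N i)" by (simp only: sum_distrib_left)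
      also have "\<dots> \<le> C * (q * (q / \<Lambda>))"
      proof (rule mult_left_mono[OF _ C])
        have "(\<Sum>i=1..n. decay N i) \<le> q * (1 / (ell N n)\<^sup>2)"
          using sum_decay_le[OF n] by (simp add: q_def)
        also have "\<dots> \<le> q * (q / \<Lambda>)" using il q by (intro mult_left_mono) auto
        finally show "(\<Sum>i=1..n. decay N i) \<le> q * (q / \<Lambda>)" .
      qed
      also have "C / \<Lambda> + C * (q * (q / \<Lambda>)) = C * (1 + q\<^sup>2) / \<Lambda>"
        by (simp add: power2_eq_square distrib_left add_divide_distrib)
      also have "\<dots> \<le> C * (2 * q\<^sup>2) / \<Lambda>"
        using C \<Lambda> q qq by (intro divide_right_mono mult_left_mono) auto
      finally show "(\<Sum>i<n-m. \<bar>v i\<bar>) \<le> 2 * C * q\<^sup>2 / \<Lambda>" by (simp add: mult_ac)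
    qed simp
    also have "\<dots> = 8 * C * q\<^sup>2 / (\<Lambda> * (real n)\<^sup>2)" by (simp add: mult_ac)
    finally show ?thesis .
  qed
  have "(\<Sum>j\<le>n. dev j * v (n - j)) = (\<Sum>j\<le>m. dev j * v (n - j)) + (\<Sum>j\<in>{m<..n}. dev j * v (n - j))"
    by (subst sum.union_disjoint[symmetric]) (auto intro!: sum.cong simp: m_def)
  also have "(\<Sum>j\<le>m. dev j * v (n - j)) = (\<Sum>j\<le>m. dev j * (v (n - j) - v n)) + v n * (\<Sum>j\<le>m. dev j)"
    by (simp add: sum_distrib_left right_diff_distrib sum_subtractf mult.commute)
  finally have "\<bar>\<Sum>j\<le>n. dev j * v (n - j)\<bar> \<le> 4 * C * q\<^sup>2 / (\<Lambda> * (real n)\<^sup>2) +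
      3 * C * q\<^sup>2 / (\<Lambda> * (real n)\<^sup>2) + 8 * C * q\<^sup>2 / (\<Lambda> * (real n)\<^sup>2)"
    using T1 T2 T3 by linarith
  also have "\<dots> = 15 * C * q\<^sup>2 / (\<Lambda> * (real n)\<^sup>2)" by (simp add: add_divide_distrib[symmetric])
  also have "\<dots> \<le> 15 * C * (16 * sqrt (real n)) / (\<Lambda> * (real n)\<^sup>2)"
    using one_plus_ln_le(2)[OF n(1)] C \<Lambda> by (intro divide_right_mono mult_left_mono) (auto simp: q_def)
  also have "\<dots> = 240 * C / (\<Lambda> * (real n * sqrt (real n)))"
  proof -
    have "(real n)\<^sup>2 = real n * sqrt (real n) * sqrt (real n)" by (simp add: power2_eq_square)
    then show ?thesis using rn \<Lambda> by simp
  qed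
  finally show ?thesis unfolding \<Lambda>_def .
qed

lemma sum_inverse_sqrt_cube_le: "(\<Sum>j=1..n. 1 / (real j * sqrt (real j))) \<le> 3"
proof -
  have "(\<Sum>j=1..n. 1 / (real j * sqrt (real j))) \<le> 3 - 2 / sqrt (real n)" if "n \<ge> 1"
    using that
  proof (induction n rule: dec_induct)
    case (step n)
    define a b where "a = sqrt (real n)" and "b = sqrt (real n + 1)"
    have ab: "a \<ge> 1" "b \<ge> a" "b * b = a * a + 1" using step by (auto simp: a_def b_def)
    have "1 / (b * b * b) \<le> 2 / a - 2 / b"
    proof -
      have "(b - a) * (b + a) = 1" using ab(3) by (simp add: algebra_simps)
      then have "b - a = 1 / (b + a)" using ab by (simp add: eq_divide_eq)
      then have "2 / a - 2 / b = 2 / (a * b * (b + a))"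
        using ab by (simp add: divide_simps) (simp add: algebra_simps)
      also have "\<dots> \<ge> 2 / (b * b * (b + b))"
        using ab by (intro divide_left_mono mult_mono mult_pos_pos) auto
      also have "2 / (b * b * (b + b)) = 1 / (b * b * b)" using ab by (simp add: divide_simps)
      finally show ?thesis .
    qed
    moreover have sb: "sqrt (real (Suc n)) = b" by (simp add: b_def add_ac)
    moreover have "(\<Sum>j=1..Suc n. 1 / (real j * sqrt (real j))) = (\<Sum>j=1..n. 1 / (real j * sqrt (real j))) + 1 / (b * b * b)"
      by (simp add: b_def add_ac)
    ultimately show ?case using step.IH unfolding a_def sb by linarith
  qed simp
  then show ?thesis by (cases "n \<ge> 1") (auto simp: not_le intro: order_trans)
qed

lemma conv_decay_le:
  assumes n: "1 \<le> n" "n \<le> N"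
  shows "(\<Sum>j\<in>{1..<n}. 1 / (real j * sqrt (real j)) * decay N (n - j)) \<le> 12 * decay N n"
proof -
  define m where "m = n div 2"
  define r where "r j = 1 / (real j * sqrt (real j))" for j :: nat
  have r0: "r j \<ge> 0" for j by (simp add: r_def)
  have l: "ell N n \<ge> 1" by (rule ell_ge_1[OF n])
  have rn: "real n \<ge> 1" using n by simp
  have B: "decay N n > 0" by (rule decay_pos[OF n])
  have B0: "i \<le> N \<Longrightarrow> decay N i \<ge> 0" for i by (simp add: decay_def)
  have "(\<Sum>j\<in>{1..<n}. r j * decay N (n - j)) \<le> (\<Sum>j\<in>{1..<n}. r j * (2 * decay N n) * of_bool (j \<le> m) +
      3 / (real n * sqrt (real n)) * decay N (n - j))"
  proof (rule sum_mono)
    fix j assume j: "j \<in> {1..<n}"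
    show "r j * decay N (n - j) \<le> r j * (2 * decay N n) * of_bool (j \<le> m) +
      3 / (real n * sqrt (real n)) * decay N (n - j)"
    proof (cases "j \<le> m")
      case True
      have "decay N (n - j) \<le> 2 * decay N n" using j n True by (intro decay_le_double) (auto simp: m_def)
      then have "r j * decay N (n - j) \<le> r j * (2 * decay N n)" using r0 by (rule mult_left_mono)
      moreover have "3 / (real n * sqrt (real n)) * decay N (n - j) \<ge> 0"
        using B0[of "n - j"] n by simp
      ultimately show ?thesis using True by simp
    next
      case False
      then have jn: "real n / 2 \<le> real j" by (auto simp: m_def)
      have "r j \<le> 1 / (real n / 2 * sqrt (real n / 2))"
        unfolding r_def using jn rn by (intro divide_left_mono mult_mono) auto
      also have "\<dots> = 2 * sqrt 2 / (real n * sqrt (real n))"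
        using rn by (simp add: real_sqrt_divide)
      also have "\<dots> \<le> 3 / (real n * sqrt (real n))"
      proof (rule divide_right_mono)
        have "sqrt 2 \<le> sqrt ((3 / 2)\<^sup>2)" by (intro real_sqrt_le_mono) (simp add: power2_eq_square)
        then show "2 * sqrt 2 \<le> (3::real)" by simp
      qed simp
      finally have "r j * decay N (n - j) \<le> 3 / (real n * sqrt (real n)) * decay N (n - j)"
        using B0[of "n - j"] n by (intro mult_right_mono) auto
      then show ?thesis using False by simp
    qed
  qed
  also have "\<dots> = (\<Sum>j\<in>{1..<n}. r j * of_bool (j \<le> m)) * (2 * decay N n) +
      3 / (real n * sqrt (real n)) * (\<Sum>j\<in>{1..<n}. decay N (n - j))"
    by (simp only: sum.distrib sum_distrib_left sum_distrib_right mult_ac)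
  also have "\<dots> \<le> 3 * (2 * decay N n) + 3 / (real n * sqrt (real n)) * (2 * sqrt (real n) / (ell N n)\<^sup>2)"
  proof (intro add_mono mult_right_mono mult_left_mono)
    have "(\<Sum>j\<in>{1..<n}. r j * of_bool (j \<le> m)) \<le> (\<Sum>j=1..n. r j)"
      using r0 by (intro order_trans[OF sum_mono sum_mono2]) (auto simp: of_bool_def)
    also have "\<dots> \<le> 3" unfolding r_def by (rule sum_inverse_sqrt_cube_le)
    finally show "(\<Sum>j\<in>{1..<n}. r j * of_bool (j \<le> m)) \<le> 3" .
    have "(\<Sum>j\<in>{1..<n}. decay N (n - j)) = (\<Sum>i\<in>{1..<n}. decay N i)"
      by (rule sum.reindex_bij_witness[of _ "\<lambda>i. n - i" "\<lambda>i. n - i"]) auto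
    also have "\<dots> \<le> (\<Sum>i=1..n. decay N i)" using B0 n by (intro sum_mono2) auto
    also have "\<dots> \<le> (1 + ln (real n)) / (ell N n)\<^sup>2" by (rule sum_decay_le[OF n])
    also have "\<dots> \<le> 2 * sqrt (real n) / (ell N n)\<^sup>2"
      using one_plus_ln_le(1)[OF n(1)] by (rule divide_right_mono) simp
    finally show "(\<Sum>j\<in>{1..<n}. decay N (n - j)) \<le> 2 * sqrt (real n) / (ell N n)\<^sup>2" .
  qed (use B in auto)
  also have "3 / (real n * sqrt (real n)) * (2 * sqrt (real n) / (ell N n)\<^sup>2) = 6 * decay N n"
    using rn l by (simp add: decay_def)
  finally show ?thesis unfolding r_def by simp
qed

lemma renewal_perturbation:
  fixes v h w :: "nat \<Rightarrow> real"
  assumes eq: "\<And>n. n \<le> N \<Longrightarrow> w n = v n + (\<Sum>j\<le>n. h j * w (n - j))"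
    and C: "C \<ge> 0" and D: "D \<ge> 0" and N: "N \<ge> 1"
    and v0: "\<bar>v 0\<bar> \<le> C / (1 + ln (real N))"
    and v: "\<And>n. 1 \<le> n \<Longrightarrow> n \<le> N \<Longrightarrow> \<bar>v n\<bar> \<le> C * decay N n"
    and h0: "\<bar>h 0\<bar> \<le> D / (1 + ln (real N))"
    and h: "\<And>n. 1 \<le> n \<Longrightarrow> n \<le> N \<Longrightarrow> \<bar>h n\<bar> \<le> D / ((1 + ln (real N)) * (real n * sqrt (real n)))"
    and big: "48 * D \<le> 1 + ln (real N)"
    and n: "1 \<le> n" "n \<le> N"
  shows "\<bar>w n\<bar> \<le> 2 * (C + 2 * C * D) * decay N n"
    and "\<bar>w n - v n\<bar> \<le> (13 * D * (2 * (C + 2 * C * D)) / (1 + ln (real N)) + 2 * C * D / sqrt (real n)) * decay N n"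
proof -
  define \<Lambda> where "\<Lambda> = 1 + ln (real N)"
  define M where "M = 2 * (C + 2 * C * D)"
  have \<Lambda>: "\<Lambda> \<ge> 1" using N by (simp add: \<Lambda>_def)
  have M: "M \<ge> 0" using C D by (simp add: M_def)
  have D48: "D / \<Lambda> \<le> 1 / 48" using big \<Lambda> by (simp add: \<Lambda>_def divide_simps)
  have w0: "\<bar>w 0\<bar> \<le> 2 * C / \<Lambda>"
  proof -
    have "w 0 = v 0 + h 0 * w 0" using eq[of 0] by simp
    then have "\<bar>w 0\<bar> \<le> \<bar>v 0\<bar> + \<bar>h 0\<bar> * \<bar>w 0\<bar>" by (metis abs_mult abs_triangle_ineq)
    also have "\<bar>h 0\<bar> * \<bar>w 0\<bar> \<le> 1 / 48 * \<bar>w 0\<bar>"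
      using h0 D48 unfolding \<Lambda>_def by (intro mult_right_mono) linarith+
    finally have "\<bar>w 0\<bar> \<le> 2 * \<bar>v 0\<bar>" by simp
    then show ?thesis using v0 by (simp add: \<Lambda>_def)
  qed
  have step: "\<bar>w k - v k\<bar> \<le> D / \<Lambda> * \<bar>w k\<bar> + 2 * C * D / sqrt (real k) * decay N k + 12 * D * M / \<Lambda> * decay N k"
    if k: "1 \<le> k" "k \<le> N" and IH: "\<And>i. 1 \<le> i \<Longrightarrow> i < k \<Longrightarrow> \<bar>w i\<bar> \<le> M * decay N i" for k
  proof -
    have "{..k} = insert 0 (insert k {1..<k})" using k by auto
    then have "(\<Sum>j\<le>k. h j * w (k - j)) = h 0 * w k + h k * w 0 + (\<Sum>j\<in>{1..<k}. h j * w (k - j))"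
      using k by simp
    then have "\<bar>w k - v k\<bar> \<le> \<bar>h 0 * w k\<bar> + \<bar>h k * w 0\<bar> + \<bar>\<Sum>j\<in>{1..<k}. h j * w (k - j)\<bar>"
      using eq[OF k(2)] by linarith
    also have "\<bar>h 0 * w k\<bar> \<le> D / \<Lambda> * \<bar>w k\<bar>"
      unfolding abs_mult using h0 by (intro mult_right_mono) (auto simp: \<Lambda>_def)
    also have "\<bar>h k * w 0\<bar> \<le> D / (\<Lambda> * (real k * sqrt (real k))) * (2 * C / \<Lambda>)"
      unfolding abs_mult using h[OF k] w0 D \<Lambda> by (intro mult_mono) (auto simp: \<Lambda>_def)
    also have "\<dots> \<le> 2 * C * D / sqrt (real k) * decay N k"
    proof -
      have l: "1 \<le> ell N k" "ell N k \<le> \<Lambda>" using ell_ge_1[OF k] ell_le[OF k] by (auto simp: \<Lambda>_def)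
      have "D / (\<Lambda> * (real k * sqrt (real k))) * (2 * C / \<Lambda>) = 2 * C * D / sqrt (real k) * (1 / (real k * \<Lambda>\<^sup>2))"
        by (simp add: power2_eq_square mult_ac)
      also have "\<dots> \<le> 2 * C * D / sqrt (real k) * decay N k"
        unfolding decay_def using C D k l
        by (intro mult_left_mono divide_left_mono power_mono) auto
      finally show ?thesis .
    qed
    also have "\<bar>\<Sum>j\<in>{1..<k}. h j * w (k - j)\<bar> \<le> 12 * D * M / \<Lambda> * decay N k"
    proof -
      have "\<bar>\<Sum>j\<in>{1..<k}. h j * w (k - j)\<bar> \<le> (\<Sum>j\<in>{1..<k}. \<bar>h j * w (k - j)\<bar>)" by (rule sum_abs)
      also have "\<dots> \<le> (\<Sum>j\<in>{1..<k}. D * M / \<Lambda> * (1 / (real j * sqrt (real j)) * decay N (k - j)))"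
      proof (rule sum_mono)
        fix j assume j: "j \<in> {1..<k}"
        have "\<bar>h j * w (k - j)\<bar> \<le> D / (\<Lambda> * (real j * sqrt (real j))) * (M * decay N (k - j))"
          unfolding abs_mult \<Lambda>_def using j k D \<Lambda>
          by (intro mult_mono h IH) (auto simp: \<Lambda>_def)
        then show "\<bar>h j * w (k - j)\<bar> \<le> D * M / \<Lambda> * (1 / (real j * sqrt (real j)) * decay N (k - j))"
          by (simp add: mult_ac)
      qed
      also have "\<dots> = D * M / \<Lambda> * (\<Sum>j\<in>{1..<k}. 1 / (real j * sqrt (real j)) * decay N (k - j))"
        by (simp only: sum_distrib_left)
      also have "\<dots> \<le> D * M / \<Lambda> * (12 * decay N k)"
        using conv_decay_le[OF k] D M \<Lambda> by (intro mult_left_mono) auto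
      finally show ?thesis by (simp add: mult_ac)
    qed
    finally show ?thesis by simp
  qed
  have bound: "\<bar>w k\<bar> \<le> M * decay N k" if "1 \<le> k" "k \<le> N" for k
    using that
  proof (induction k rule: less_induct)
    case (less k)
    have B: "decay N k > 0" using less.prems by (rule decay_pos)
    have "\<bar>w k - v k\<bar> \<le> D / \<Lambda> * \<bar>w k\<bar> + 2 * C * D / sqrt (real k) * decay N k + 12 * D * M / \<Lambda> * decay N k"
      using less by (intro step) auto
    moreover have "D / \<Lambda> * \<bar>w k\<bar> \<le> 1 / 48 * \<bar>w k\<bar>" using D48 by (rule mult_right_mono) simp
    moreover have "2 * C * D / sqrt (real k) * decay N k \<le> 2 * C * D * decay N k"
      using less.prems mult_nonneg_nonneg[OF C D] B by (intro mult_right_mono) (auto simp: divide_le_eq mult_le_cancel_left1)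
    moreover have "12 * D * M / \<Lambda> * decay N k \<le> (M * decay N k) / 4"
      using mult_right_mono[OF D48, of "12 * M * decay N k"] M B by (simp add: mult_ac)
    moreover have "\<bar>v k\<bar> \<le> C * decay N k" using less.prems by (rule v)
    moreover have "C * decay N k + 2 * C * D * decay N k = (M * decay N k) / 2" by (simp add: M_def algebra_simps)
    moreover have "M * decay N k \<ge> 0" using M B by simp
    ultimately show ?case by linarith
  qed
  show "\<bar>w n\<bar> \<le> 2 * (C + 2 * C * D) * decay N n" using bound[OF n] by (simp add: M_def)
  have "\<bar>w n - v n\<bar> \<le> D / \<Lambda> * \<bar>w n\<bar> + 2 * C * D / sqrt (real n) * decay N n + 12 * D * M / \<Lambda> * decay N n"
    using n bound by (intro step) auto
  also have "D / \<Lambda> * \<bar>w n\<bar> \<le> D / \<Lambda> * (M * decay N n)"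
    using bound[OF n] D \<Lambda> by (intro mult_left_mono) auto
  finally have "\<bar>w n - v n\<bar> \<le> (13 * D * M / \<Lambda> + 2 * C * D / sqrt (real n)) * decay N n"
    by (simp add: algebra_simps)
  then show "\<bar>w n - v n\<bar> \<le> (13 * D * (2 * (C + 2 * C * D)) / (1 + ln (real N)) + 2 * C * D / sqrt (real n)) * decay N n"
    by (simp add: M_def \<Lambda>_def)
qed

lemma renewal_transform:
  fixes w :: "nat \<Rightarrow> real" and s :: real
  assumes s: "s \<noteq> 0"
    and w: "\<And>n. w n = ret2 n + s * (\<Sum>m=1..n-1. w m * ret2 (n - m))"
    and k: "k = pi / s - dev_sum" "k > 0"
  defines "u \<equiv> \<lambda>n. if n = 0 then s / pi else s\<^sup>2 / pi * w n"
  shows "u n = vren k n + (\<Sum>j\<le>n. (\<Sum>i\<le>j. dev i * vren k (j - i)) * u (n - j))"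
proof -
  define W where "W = Abs_fps (\<lambda>n. if n = 0 then 0 else w n)"
  define A where "A = Abs_fps (\<lambda>n. if n = 0 then 0 else ret2 n)"
  define L where "L = Abs_fps (\<lambda>n. if n = 0 then 0 else 1 / real n)"
  define V where "V = Abs_fps (vren k)"
  define E where "E = Abs_fps dev"
  define U where "U = Abs_fps u"
  have WA: "W = A + fps_const s * (W * A)"
  proof (rule fps_ext)
    fix n
    show "fps_nth W n = fps_nth (A + fps_const s * (W * A)) n"
    proof (cases "n = 0")
      case False
      have "fps_nth (W * A) n = (\<Sum>i=0..n. fps_nth W i * fps_nth A (n - i))" by (rule fps_mult_nth)
      also have "\<dots> = (\<Sum>m=1..n-1. w m * ret2 (n - m))"
        using False by (intro sum.mono_neutral_cong_right) (auto simp: W_def A_def Suc_le_eq)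
      finally show ?thesis using False w[of n] by (simp add: W_def A_def)
    qed (simp add: W_def A_def)
  qed
  have U: "U = fps_const (s / pi) * (1 + fps_const s * W)"
    by (rule fps_ext) (auto simp: U_def u_def W_def power2_eq_square)
  have ss: "fps_const (s / pi) * fps_const (pi / s) = 1" "fps_const pi = fps_const (pi / s) * fps_const s"
    using s by simp_all
  have UA: "U * (fps_const (pi / s) - fps_const pi * A) = 1"
  proof -
    have "U * (fps_const (pi / s) - fps_const pi * A) =
       (fps_const (s / pi) * fps_const (pi / s)) * ((1 + fps_const s * W) * (1 - fps_const s * A))"
      unfolding U ss(2) by (simp only: algebra_simps mult_1_left mult_1_right)
    also have "(1 + fps_const s * W) * (1 - fps_const s * A) = 1 + fps_const s * (W - (A + fps_const s * (W * A)))"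
      by (simp add: algebra_simps)
    also have "\<dots> = 1" using WA by simp
    finally show ?thesis by (simp only: ss(1) mult_1)
  qed
  have VL: "V * (fps_const k - L) = 1"
  proof (rule fps_ext)
    fix n
    have "fps_nth (V * L) n = fps_nth (L * V) n" by (simp add: mult.commute)
    also have "\<dots> = (\<Sum>i=0..n. fps_nth L i * fps_nth V (n - i))" by (rule fps_mult_nth)
    also have "\<dots> = (\<Sum>j=1..n. vren k (n - j) / real j)"
      by (intro sum.mono_neutral_cong_right) (auto simp: L_def V_def Suc_le_eq)
    finally show "fps_nth (V * (fps_const k - L)) n = fps_nth 1 n"
      using vren_renewal[OF k(2), of n] by (simp add: right_diff_distrib V_def mult.commute)
  qed
  have AE: "fps_const (pi / s) - fps_const pi * A = fps_const k - L - E"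
    by (rule fps_ext) (auto simp: A_def L_def E_def dev_def k(1))
  have "U = U * (V * (fps_const k - L))" by (simp add: VL)
  also have "\<dots> = V * (U * (fps_const k - L - E)) + (E * V) * U" by (simp add: algebra_simps)
  also have "\<dots> = V + (E * V) * U" using UA unfolding AE by simp
  finally have "fps_nth U n = fps_nth V n + fps_nth ((E * V) * U) n" by (metis fps_add_nth)
  also have "fps_nth ((E * V) * U) n = (\<Sum>j\<le>n. (\<Sum>i\<le>j. dev i * vren k (j - i)) * u (n - j))"
    by (simp add: fps_mult_nth E_def V_def U_def atLeast0AtMost)
  finally show ?thesis by (simp add: U_def V_def)
qed

section \<open>Asymptotics of the parameters and of the limit kernel\<close>

lemma pi_sum_ret2_asymp: "(\<lambda>N. pi * (\<Sum>n=1..N. ret2 n) - ln (real N)) \<longlonglongrightarrow> euler_mascheroni + dev_sum"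
proof -
  have "pi * (\<Sum>n=1..N. ret2 n) = harm N + ((\<Sum>j\<le>N. dev j) + dev_sum)" for N
  proof (induction N)
    case 0
    then show ?case by (simp add: harm_def dev_def)
  next
    case (Suc N)
    then show ?case by (simp add: harm_Suc dev_def distrib_left inverse_eq_divide)
  qed
  then have "(\<lambda>N. pi * (\<Sum>n=1..N. ret2 n) - ln (real N)) =
      (\<lambda>N. (harm N - ln (real N)) + ((\<Sum>j\<le>N. dev j) + dev_sum))"
    by (simp add: fun_eq_iff)
  moreover have "\<dots> \<longlonglongrightarrow> euler_mascheroni + (0 + dev_sum)"
    by (intro tendsto_intros euler_mascheroni_LIMSEQ sum_dev_LIMSEQ)
  ultimately show ?thesis by simp
qed

lemma ln_at_top: "filterlim (\<lambda>N. ln (real N)) at_top sequentially"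
  by real_asymp

lemma kappa_asymp:
  fixes s eps :: "nat \<Rightarrow> real"
  assumes eps: "eps \<longlonglongrightarrow> 0"
    and s: "\<forall>\<^sub>F N in sequentially. s N = 1 / (\<Sum>n=1..N. ret2 n) * (1 + th / ln (real N) * (1 + eps N))"
  shows "(\<lambda>N. pi / s N - dev_sum - ln (real N)) \<longlonglongrightarrow> euler_mascheroni - th"
    and "(\<lambda>N. pi / s N / ln (real N)) \<longlonglongrightarrow> 1"
    and "\<forall>\<^sub>F N in sequentially. s N > 0"
proof -
  define P where "P N = pi * (\<Sum>n=1..N. ret2 n) - ln (real N)" for N
  define x where "x N = th / ln (real N) * (1 + eps N)" for N
  have P: "P \<longlonglongrightarrow> euler_mascheroni + dev_sum"
    unfolding P_def[abs_def] by (rule pi_sum_ret2_asymp)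
  have ln0: "(\<lambda>N. th / ln (real N)) \<longlonglongrightarrow> 0" by real_asymp
  have "x \<longlonglongrightarrow> 0 * (1 + 0)"
    unfolding x_def[abs_def] by (intro tendsto_intros eps ln0)
  then have x: "x \<longlonglongrightarrow> 0" by simp
  have ev: "\<forall>\<^sub>F N in sequentially. \<bar>x N\<bar> < 1"
    using tendstoD[OF x, of 1] by (simp add: dist_real_def)
  have lnx: "(\<lambda>N. th * (1 + eps N)) \<longlonglongrightarrow> th * (1 + 0)"
    by (intro tendsto_intros eps)
  have pos: "\<forall>\<^sub>F N in sequentially. (\<Sum>n=1..N. ret2 n) > 0"
    using eventually_ge_at_top[of 1] by eventually_elim (auto intro!: sum_pos ret2_pos)
  show "\<forall>\<^sub>F N in sequentially. s N > 0"
    using s pos ev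
  proof eventually_elim
    case (elim N)
    have "1 + x N > 0" using elim(3) by linarith
    moreover have "s N = 1 / (\<Sum>n=1..N. ret2 n) * (1 + x N)" unfolding x_def by (rule elim(1))
    ultimately show ?case using elim(2) by simp
  qed
  have eq: "\<forall>\<^sub>F N in sequentially. pi / s N - dev_sum - ln (real N) = (P N - th * (1 + eps N)) / (1 + x N) - dev_sum"
    using s pos ev eventually_gt_at_top[of 1]
  proof eventually_elim
    case (elim N)
    have l: "ln (real N) > 0" using elim by simp
    have 1: "1 + x N \<noteq> 0" using elim by auto
    have "pi / s N = (P N + ln (real N)) / (1 + x N)"
      using elim by (simp add: P_def x_def)
    then have "pi / s N - ln (real N) = (P N - ln (real N) * x N) / (1 + x N)"
      using 1 by (simp add: field_simps)
    also have "ln (real N) * x N = th * (1 + eps N)" using l by (simp add: x_def)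
    finally show ?case by simp
  qed
  have "(\<lambda>N. (P N - th * (1 + eps N)) / (1 + x N) - dev_sum) \<longlonglongrightarrow>
     (euler_mascheroni + dev_sum - th * (1 + 0)) / (1 + 0) - dev_sum"
    by (intro tendsto_intros P lnx x eps) auto
  then show lim: "(\<lambda>N. pi / s N - dev_sum - ln (real N)) \<longlonglongrightarrow> euler_mascheroni - th"
    using tendsto_cong[OF eq] by simp
  have inv_ln: "(\<lambda>N. 1 / ln (real N)) \<longlonglongrightarrow> 0" by real_asymp
  have "(\<lambda>N. (pi / s N - dev_sum - ln (real N)) * (1 / ln (real N)) + dev_sum * (1 / ln (real N)) + 1)
      \<longlonglongrightarrow> (euler_mascheroni - th) * 0 + dev_sum * 0 + 1"
    by (rule tendsto_add[OF tendsto_add[OF tendsto_mult[OF lim inv_ln] tendsto_mult[OF tendsto_const inv_ln]] tendsto_const])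
  moreover have "\<forall>\<^sub>F N in sequentially. (pi / s N - dev_sum - ln (real N)) * (1 / ln (real N)) + dev_sum * (1 / ln (real N)) + 1 = pi / s N / ln (real N)"
    using eventually_gt_at_top[of 1] by eventually_elim (simp add: diff_divide_distrib add_divide_distrib)
  ultimately show "(\<lambda>N. pi / s N / ln (real N)) \<longlonglongrightarrow> 1"
    using tendsto_cong by fastforce
qed

lemma pker_LIMSEQ:
  fixes x :: real
  assumes x: "x \<ge> 0"
  shows "(\<lambda>n. real n * exp (- (ln (real n) * x)) * pker n x) \<longlonglongrightarrow> x * rGamma (x + 1)"
proof -
  have "rGamma_series x \<longlonglongrightarrow> x * rGamma (x + 1)"
    using rGamma_series_LIMSEQ[of x] rGamma_plus1[of x] by simp
  moreover have "(\<lambda>n. real n / (x + real n)) \<longlonglongrightarrow> 1" by real_asymp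
  ultimately have "(\<lambda>n. rGamma_series x n * (real n / (x + real n))) \<longlonglongrightarrow> x * rGamma (x + 1) * 1"
    by (rule tendsto_mult)
  moreover have "\<forall>\<^sub>F n in sequentially. rGamma_series x n * (real n / (x + real n)) = real n * exp (- (ln (real n) * x)) * pker n x"
    using eventually_ge_at_top[of 1]
  proof eventually_elim
    case (elim n)
    then have "x + real n \<noteq> 0" using x by auto
    then show ?case
      by (simp add: rGamma_series_def pker_def pochhammer_Suc exp_minus divide_simps mult_ac)
  qed
  ultimately show ?thesis using tendsto_cong by fastforce
qed

lemma rGamma_exp_bound:
  fixes c :: real
  assumes c: "c \<ge> 0"
  shows "\<exists>C>0. \<forall>x\<ge>0. exp (c * x) * (x * rGamma (x + 1)) \<le> C * (x * exp (- (1 / 4 * x)))"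
proof -
  obtain C where C: "C > 0" and bound: "\<And>N k n x. 2 * c + 1 \<le> ln (real N) \<Longrightarrow> ln (real N) - c \<le> k \<Longrightarrow>
     1 \<le> n \<Longrightarrow> n \<le> N \<Longrightarrow> 0 \<le> x \<Longrightarrow> exp (- (k * x)) * pker n x \<le> C / real n * (x * exp (- (ell N n / 4 * x)))"
    using pker_bound[OF c] by blast
  show ?thesis
  proof (intro exI[of _ C] conjI allI impI)
    fix x :: real assume x: "x \<ge> 0"
    have "(\<lambda>n. exp (c * x) * (real n * exp (- (ln (real n) * x)) * pker n x)) \<longlonglongrightarrow> exp (c * x) * (x * rGamma (x + 1))"
      by (intro tendsto_intros pker_LIMSEQ x)
    moreover have "\<forall>\<^sub>F n in sequentially. exp (c * x) * (real n * exp (- (ln (real n) * x)) * pker n x) \<le> C * (x * exp (- (1 / 4 * x)))"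
      using eventually_ge_at_top[of 1] filterlim_at_top[THEN iffD1, OF ln_at_top, rule_format, of "2 * c + 1"]
    proof eventually_elim
      case (elim n)
      have "exp (- ((ln (real n) - c) * x)) * pker n x \<le> C / real n * (x * exp (- (ell n n / 4 * x)))"
        using elim x by (intro bound) auto
      then have "real n * (exp (- ((ln (real n) - c) * x)) * pker n x) \<le> real n * (C / real n * (x * exp (- (ell n n / 4 * x))))"
        by (rule mult_left_mono) simp
      also have "\<dots> = C * (x * exp (- (1 / 4 * x)))" using elim by (simp add: ell_def)
      also have "exp (- ((ln (real n) - c) * x)) = exp (c * x) * exp (- (ln (real n) * x))"
        by (simp add: exp_add[symmetric] algebra_simps)
      finally show ?case by (simp add: mult_ac)
    qed
    ultimately show "exp (c * x) * (x * rGamma (x + 1)) \<le> C * (x * exp (- (1 / 4 * x)))"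
      by (rule tendsto_upperbound) simp
  qed (use C in auto)
qed

definition Gint :: "real \<Rightarrow> real \<Rightarrow> real \<Rightarrow> real" where
  "Gint th t x = exp ((th - euler_mascheroni) * x) * (x * rGamma (x + 1)) * t powr (x - 1)"

lemma Gint_measurable [measurable]: "Gint th t \<in> borel_measurable borel"
proof -
  have "continuous_on UNIV (\<lambda>x::real. rGamma (x + 1))"
    by (rule continuous_on_compose2[OF continuous_on_rGamma]) (auto intro!: continuous_intros)
  then have [measurable]: "(\<lambda>x::real. rGamma (x + 1)) \<in> borel_measurable borel"
    by (rule borel_measurable_continuous_onI)
  show ?thesis unfolding Gint_def[abs_def] by measurable
qed

lemma rGamma_real_pos: "x > 0 \<Longrightarrow> rGamma (x::real) > 0"
  by (simp add: rGamma_inverse_Gamma Gamma_real_pos)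

lemma Gint_nonneg: "x \<ge> 0 \<Longrightarrow> Gint th t x \<ge> 0"
  using rGamma_real_pos[of "x + 1"] by (simp add: Gint_def)

lemma powr_minus_one_le:
  fixes t x d :: real
  assumes "0 < d" "d \<le> t" "t \<le> 1" "x \<ge> 0"
  shows "t powr (x - 1) \<le> 1 / d"
proof -
  have "t powr (x - 1) = t powr x / t" using assms by (simp add: powr_diff)
  also have "\<dots> \<le> 1 / d" using assms by (intro frac_le powr_le1) auto
  finally show ?thesis .
qed

lemma Gint_bound:
  "\<exists>C>0. \<forall>d t x. 0 < d \<longrightarrow> d \<le> t \<longrightarrow> t \<le> 1 \<longrightarrow> 0 \<le> x \<longrightarrow> Gint th t x \<le> C / d * (x * exp (- (1 / 4 * x)))"
proof -
  obtain C where C: "C > 0" "\<And>x. x \<ge> 0 \<Longrightarrow> exp (\<bar>th - euler_mascheroni\<bar> * x) * (x * rGamma (x + 1)) \<le> C * (x * exp (- (1 / 4 * x)))"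
    using rGamma_exp_bound[of "\<bar>th - euler_mascheroni\<bar>"] by auto
  show ?thesis
  proof (intro exI[of _ C] conjI allI impI)
    fix d t x :: real assume d: "0 < d" "d \<le> t" "t \<le> 1" and x: "0 \<le> x"
    have r: "x * rGamma (x + 1) \<ge> 0" using rGamma_real_pos[of "x + 1"] x by simp
    have "exp ((th - euler_mascheroni) * x) * (x * rGamma (x + 1)) \<le> exp (\<bar>th - euler_mascheroni\<bar> * x) * (x * rGamma (x + 1))"
      using x r by (intro mult_right_mono) (auto intro: mult_right_mono)
    also note C(2)[OF x]
    finally have "Gint th t x \<le> C * (x * exp (- (1 / 4 * x))) * (1 / d)"
      unfolding Gint_def by (rule mult_mono[OF _ powr_minus_one_le[OF d x]]) (use x C in auto)
    then show "Gint th t x \<le> C / d * (x * exp (- (1 / 4 * x)))" by simp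
  qed (use C in auto)
qed

lemma Gint_integrable:
  assumes t: "0 < t" "t \<le> 1"
  shows "set_integrable lborel {0<..} (Gint th t)"
proof -
  obtain C where C: "C > 0" "\<And>d t x. 0 < d \<Longrightarrow> d \<le> t \<Longrightarrow> t \<le> 1 \<Longrightarrow> 0 \<le> x \<Longrightarrow> Gint th t x \<le> C / d * (x * exp (- (1 / 4 * x)))"
    using Gint_bound[of th] by blast
  show ?thesis
  proof (rule set_integrable_bound[of _ _ "\<lambda>x. C / t * (x * exp (- (1 / 4 * x)))"])
    show "set_integrable lborel {0<..} (\<lambda>x. C / t * (x * exp (- (1 / 4 * x))))"
      by (intro set_integrable_mult_right integral_x_exp_Ioi) auto
    show "AE x in lborel. x \<in> {0<..} \<longrightarrow> norm (Gint th t x) \<le> norm (C / t * (x * exp (- (1 / 4 * x))))"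
      using C(1) C(2)[of t t] t Gint_nonneg[of _ th t] by (auto intro!: AE_I2)
  qed (simp add: set_borel_measurable_def)
qed

lemma Gth_eq:
  assumes t: "0 < t" "t \<le> 1"
  shows "Gint th t integrable_on {0..}" "Gth th t = integral {0..} (Gint th t)"
    and "Gth th t = (LINT x:{0<..}|lborel. Gint th t x)"
proof -
  have ind: "indicat_real {0..} x *\<^sub>R Gint th t x = indicat_real {0<..} x *\<^sub>R Gint th t x" for x
    by (cases "x = 0") (auto simp: Gint_def indicator_def)
  have int: "set_integrable lborel {0..} (Gint th t)"
    using Gint_integrable[OF t, of th] unfolding set_integrable_def ind .
  show "Gint th t integrable_on {0..}" by (rule set_borel_integral_eq_integral(1)[OF int])
  show G: "Gth th t = integral {0..} (Gint th t)"
    unfolding Gth_def Gint_def by (simp add: rGamma_inverse_Gamma field_simps)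
  show "Gth th t = (LINT x:{0<..}|lborel. Gint th t x)"
    unfolding G set_borel_integral_eq_integral(2)[OF int, symmetric] set_lebesgue_integral_def ind ..
qed

lemma Gth_lower_bound:
  "\<exists>c>0. \<forall>t. 0 < t \<longrightarrow> t \<le> 1 \<longrightarrow> c / (t * (1 + ln (1 / t))\<^sup>2) \<le> Gth th t"
proof -
  have "continuous_on {0..1} (\<lambda>x::real. rGamma (x + 1))"
    by (rule continuous_on_compose2[OF continuous_on_rGamma]) (auto intro!: continuous_intros)
  then obtain y where y: "y \<in> {0..1}" "\<And>x. x \<in> {0..1} \<Longrightarrow> rGamma (y + 1) \<le> rGamma (x + 1 :: real)"
    using continuous_attains_inf[of "{0..1::real}" "\<lambda>x. rGamma (x + 1)"] by auto
  define a where "a = exp (- \<bar>th - euler_mascheroni\<bar>) * rGamma (y + 1) * exp (- 1)"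
  have ry: "rGamma (y + 1) > 0" using y by (intro rGamma_real_pos) auto
  then have a: "a > 0" by (simp add: a_def)
  show ?thesis
  proof (intro exI[of _ "a / 2"] conjI allI impI)
    fix t :: real assume t: "0 < t" "t \<le> 1"
    define l where "l = 1 + ln (1 / t)"
    have l: "l \<ge> 1" using t by (simp add: l_def)
    have "((\<lambda>x. a / t * x) has_integral a / t * (((1 / l)\<^sup>2 - 0\<^sup>2) / 2)) {0..1/l}"
      using l by (intro has_integral_mult_right ident_has_integral) (auto simp del: zero_power2)
    then have I: "((\<lambda>x. a / t * x) has_integral (a / 2 / (t * l\<^sup>2))) {0..1/l}"
      by (simp add: power_divide mult_ac)
    have "a / 2 / (t * l\<^sup>2) = integral {0..1/l} (\<lambda>x. a / t * x)" by (rule integral_unique[OF I, symmetric])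
    also have "\<dots> \<le> integral {0..1/l} (Gint th t)"
    proof (rule integral_le)
      show "(\<lambda>x. a / t * x) integrable_on {0..1/l}" using I by blast
      show "Gint th t integrable_on {0..1/l}"
        using Gth_eq(1)[OF t] by (rule integrable_on_subinterval) auto
      fix x assume x: "x \<in> {0..1/l}"
      then have xl: "x * l \<le> 1" "0 \<le> x" using l by (auto simp: field_simps)
      have x1: "x \<le> 1" using x l by (auto intro: order_trans)
      have "t powr (x - 1) = exp (- (x * ln (1 / t))) / t"
        using t by (simp add: powr_def ln_div exp_diff left_diff_distrib)
      moreover have "x * ln (1 / t) \<le> 1" using xl unfolding l_def by (simp add: distrib_left)
      ultimately have p: "t powr (x - 1) \<ge> exp (- 1) / t" using t by (simp add: divide_right_mono)
      have "- \<bar>th - euler_mascheroni\<bar> \<le> (th - euler_mascheroni) * x"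
      proof -
        have "\<bar>(th - euler_mascheroni) * x\<bar> \<le> \<bar>th - euler_mascheroni\<bar> * 1"
          unfolding abs_mult using xl x1 by (intro mult_left_mono) auto
        from abs_le_D2[OF this] show ?thesis by (subst minus_le_iff) simp
      qed
      then have "exp (- \<bar>th - euler_mascheroni\<bar>) * (x * rGamma (y + 1)) * (exp (- 1) / t) \<le> Gint th t x"
        unfolding Gint_def using xl x1 y(2)[of x] ry p t
        by (intro mult_mono mult_left_mono) (auto intro!: mult_nonneg_nonneg less_imp_le[OF rGamma_real_pos])
      then show "a / t * x \<le> Gint th t x" by (simp add: a_def mult_ac)
    qed
    also have "\<dots> \<le> integral {0..} (Gint th t)"
      using Gth_eq(1)[OF t] integrable_on_subinterval[OF Gth_eq(1)[OF t], of 0 "1/l"]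
      by (intro integral_subset_le) (auto intro: Gint_nonneg)
    also have "\<dots> = Gth th t" by (simp add: Gth_eq(2)[OF t])
    finally show "a / 2 / (t * (1 + ln (1 / t))\<^sup>2) \<le> Gth th t" by (simp add: l_def)
  qed (use a in auto)
qed

lemma vren_LIMSEQ:
  fixes \<kappa> :: "nat \<Rightarrow> real" and \<nu> :: "nat \<Rightarrow> nat"
  assumes \<kappa>: "(\<lambda>N. \<kappa> N - ln (real N)) \<longlonglongrightarrow> euler_mascheroni - th"
    and d: "0 < d" and \<nu>: "\<And>N. d * real N \<le> real (\<nu> N)" "\<And>N. \<nu> N \<le> N"
  shows "(\<lambda>N. real N * vren (\<kappa> N) (\<nu> N) - Gth th (real (\<nu> N) / real N)) \<longlonglongrightarrow> 0"
proof -
  define c where "c = \<bar>euler_mascheroni - th\<bar> + 1"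
  have c: "c \<ge> 0" by (simp add: c_def)
  obtain C1 where C1: "C1 > 0" "\<And>N k n x. 2 * c + 1 \<le> ln (real N) \<Longrightarrow> ln (real N) - c \<le> k \<Longrightarrow>
     1 \<le> n \<Longrightarrow> n \<le> N \<Longrightarrow> 0 \<le> x \<Longrightarrow> exp (- (k * x)) * pker n x \<le> C1 / real n * (x * exp (- (ell N n / 4 * x)))"
    using pker_bound[OF c] by blast
  obtain C2 where C2: "C2 > 0" "\<And>d t x. 0 < d \<Longrightarrow> d \<le> t \<Longrightarrow> t \<le> 1 \<Longrightarrow> 0 \<le> x \<Longrightarrow> Gint th t x \<le> C2 / d * (x * exp (- (1 / 4 * x)))"
    using Gint_bound[of th] by blast
  define t where "t N = real (\<nu> N) / real N" for N
  have "\<forall>\<^sub>F N in sequentially. \<bar>\<kappa> N - ln (real N) - (euler_mascheroni - th)\<bar> < 1"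
    using tendstoD[OF \<kappa>, of 1] by (simp add: dist_real_def)
  then have "\<forall>\<^sub>F N in sequentially. 1 \<le> N \<and> 2 * c + 1 \<le> ln (real N) \<and> ln (real N) - c \<le> \<kappa> N"
    using eventually_ge_at_top[of 1] filterlim_at_top[THEN iffD1, OF ln_at_top, rule_format, of "2 * c + 1"]
    by eventually_elim (auto simp: c_def)
  then obtain N0 where N0: "\<And>N. N \<ge> N0 \<Longrightarrow> 1 \<le> N \<and> 2 * c + 1 \<le> ln (real N) \<and> ln (real N) - c \<le> \<kappa> N"
    by (auto simp: eventually_sequentially)
  have tN: "d \<le> t N" "t N \<le> 1" "0 < t N" "1 \<le> \<nu> N" "0 < \<kappa> N" if "N \<ge> N0" for N
  proof -
    have N: "real N > 0" using N0[OF that] by simp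
    show "d \<le> t N" "t N \<le> 1" using N \<nu>[of N] by (auto simp: t_def field_simps)
    then show "0 < t N" using d by simp
    then show "1 \<le> \<nu> N" by (cases "\<nu> N") (auto simp: t_def)
    show "0 < \<kappa> N" using N0[OF that] c by linarith
  qed
  have \<nu>_top: "filterlim \<nu> at_top sequentially"
  proof -
    have "filterlim (\<lambda>N. d * real N) at_top sequentially" using d by real_asymp
    then have "filterlim (\<lambda>N. real (\<nu> N)) at_top sequentially"
      by (rule filterlim_at_top_mono) (use \<nu> in auto)
    then show ?thesis by (simp add: filterlim_sequentially_iff_filterlim_real)
  qed
  define f where "f N x = indicat_real {0<..} x *\<^sub>R (real N * (exp (- (\<kappa> N * x)) * pker (\<nu> N) x) - Gint th (t N) x)" for N x
  define g where "g x = indicat_real {0<..} x *\<^sub>R ((C1 / d + C2 / d) * (x * exp (- (1 / 4 * x))))" for x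
  have "(\<lambda>i. integral\<^sup>L lborel (f (i + N0))) \<longlonglongrightarrow> integral\<^sup>L lborel (\<lambda>_::real. 0)"
  proof (rule integral_dominated_convergence[where s = "\<lambda>i. f (i + N0)" and f = "\<lambda>_. 0" and w = g])
    show "f (i + N0) \<in> borel_measurable lborel" for i unfolding f_def by measurable
    have "set_integrable lborel {0<..} (\<lambda>x. (C1 / d + C2 / d) * (x * exp (- (1 / 4 * x))))"
      by (intro set_integrable_mult_right integral_x_exp_Ioi) simp
    then show "integrable lborel g" unfolding g_def set_integrable_def .
    show "AE x in lborel. (\<lambda>i. f (i + N0) x) \<longlonglongrightarrow> 0"
    proof (intro AE_I2 LIMSEQ_ignore_initial_segment)
      fix x :: real
      show "(\<lambda>i. f i x) \<longlonglongrightarrow> 0"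
      proof (cases "x > 0")
        case True
        define q where "q n = real n * exp (- (ln (real n) * x)) * pker n x" for n
        have q: "(\<lambda>N. q (\<nu> N)) \<longlonglongrightarrow> x * rGamma (x + 1)"
          using pker_LIMSEQ[of x] True filterlim_compose[OF _ \<nu>_top] unfolding q_def by fastforce
        have "(\<lambda>N. exp (- ((\<kappa> N - ln (real N)) * x)) * q (\<nu> N) - exp ((th - euler_mascheroni) * x) * (x * rGamma (x + 1)))
           \<longlonglongrightarrow> exp (- ((euler_mascheroni - th) * x)) * (x * rGamma (x + 1)) - exp ((th - euler_mascheroni) * x) * (x * rGamma (x + 1))"
          by (intro tendsto_intros q \<kappa>)
        then have "(\<lambda>N. exp (- ((\<kappa> N - ln (real N)) * x)) * q (\<nu> N) - exp ((th - euler_mascheroni) * x) * (x * rGamma (x + 1))) \<longlonglongrightarrow> 0"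
          by (simp add: algebra_simps)
        then have lim: "(\<lambda>N. (1 / d) * \<bar>exp (- ((\<kappa> N - ln (real N)) * x)) * q (\<nu> N) - exp ((th - euler_mascheroni) * x) * (x * rGamma (x + 1))\<bar>) \<longlonglongrightarrow> 0"
          by (intro tendsto_mult_right_zero tendsto_rabs_zero)
        show ?thesis
        proof (rule Lim_null_comparison[OF _ lim])
          show "\<forall>\<^sub>F N in sequentially. norm (f N x) \<le> (1 / d) * \<bar>exp (- ((\<kappa> N - ln (real N)) * x)) * q (\<nu> N) - exp ((th - euler_mascheroni) * x) * (x * rGamma (x + 1))\<bar>"
            using eventually_ge_at_top[of N0]
          proof eventually_elim
            case (elim N)
            have N: "real N > 0" "real (\<nu> N) > 0" using N0[OF elim] tN(4)[OF elim] by auto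
            have tp: "t N powr (x - 1) = exp (ln (real (\<nu> N)) * x) * exp (- (ln (real N) * x)) * (real N / real (\<nu> N))"
              using N by (simp add: t_def powr_def ln_div exp_diff exp_add exp_minus algebra_simps inverse_eq_divide)
            have "real N * (exp (- (\<kappa> N * x)) * pker (\<nu> N) x) = t N powr (x - 1) * (exp (- ((\<kappa> N - ln (real N)) * x)) * q (\<nu> N))"
            proof -
              have "t N powr (x - 1) * (exp (- ((\<kappa> N - ln (real N)) * x)) * q (\<nu> N)) =
                 (exp (ln (real (\<nu> N)) * x) * exp (- (ln (real (\<nu> N)) * x))) *
                 (exp (- (ln (real N) * x)) * exp (- ((\<kappa> N - ln (real N)) * x))) * (real N * pker (\<nu> N) x)"
                unfolding tp q_def using N by simp
              also have "exp (ln (real (\<nu> N)) * x) * exp (- (ln (real (\<nu> N)) * x)) = 1"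
                by (simp add: exp_minus)
              also have "exp (- (ln (real N) * x)) * exp (- ((\<kappa> N - ln (real N)) * x)) = exp (- (\<kappa> N * x))"
                by (simp add: exp_add[symmetric] algebra_simps)
              finally show ?thesis by simp
            qed
            then have "f N x = t N powr (x - 1) * (exp (- ((\<kappa> N - ln (real N)) * x)) * q (\<nu> N) - exp ((th - euler_mascheroni) * x) * (x * rGamma (x + 1)))"
              using True by (simp add: f_def Gint_def right_diff_distrib mult_ac)
            then show ?case
              using powr_minus_one_le[OF d tN(1,2)[OF elim], of x] True
              by (simp only: real_norm_def abs_mult abs_of_nonneg[OF powr_ge_zero]) (intro mult_right_mono, auto)
          qed
        qed
      qed (simp add: f_def)
    qed
    show "AE x in lborel. norm (f (i + N0) x) \<le> g x" for i
    proof (intro AE_I2)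
      fix x :: real
      define N where "N = i + N0"
      have N: "N \<ge> N0" by (simp add: N_def)
      show "norm (f (i + N0) x) \<le> g x"
      proof (cases "x > 0")
        case True
        have rN: "real N > 0" "real (\<nu> N) > 0" using N0[OF N] tN(4)[OF N] by auto
        have "exp (- (\<kappa> N * x)) * pker (\<nu> N) x \<le> C1 / real (\<nu> N) * (x * exp (- (ell N (\<nu> N) / 4 * x)))"
          using N0[OF N] tN[OF N] \<nu> True by (intro C1(2)) auto
        also have "\<dots> \<le> C1 / real (\<nu> N) * (x * exp (- (1 / 4 * x)))"
          using C1(1) True ell_ge_1[OF tN(4)[OF N] \<nu>(2)] by (intro mult_left_mono) auto
        finally have "real N * (exp (- (\<kappa> N * x)) * pker (\<nu> N) x) \<le> real N * (C1 / real (\<nu> N) * (x * exp (- (1 / 4 * x))))"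
          by (rule mult_left_mono) simp
        also have "\<dots> = (C1 * (x * exp (- (1 / 4 * x)))) * (real N / real (\<nu> N))" by simp
        also have "\<dots> \<le> (C1 * (x * exp (- (1 / 4 * x)))) * (1 / d)"
          using C1(1) True \<nu>(1)[of N] rN d by (intro mult_left_mono) (auto simp: field_simps)
        finally have a: "real N * (exp (- (\<kappa> N * x)) * pker (\<nu> N) x) \<le> C1 / d * (x * exp (- (1 / 4 * x)))" by simp
        have b: "Gint th (t N) x \<le> C2 / d * (x * exp (- (1 / 4 * x)))"
          using d tN[OF N] True by (intro C2(2)) auto
        have "\<bar>real N * (exp (- (\<kappa> N * x)) * pker (\<nu> N) x) - Gint th (t N) x\<bar> \<le>
            C1 / d * (x * exp (- (1 / 4 * x))) + C2 / d * (x * exp (- (1 / 4 * x)))"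
          using a b Gint_nonneg[of x th "t N"] pker_nonneg[of x "\<nu> N"] True
          by (smt (verit) exp_ge_zero mult_nonneg_nonneg of_nat_0_le_iff)
        then show ?thesis using True by (simp add: f_def g_def N_def[symmetric] distrib_right)
      qed (simp add: f_def g_def)
    qed
  qed simp
  then have "(\<lambda>N. integral\<^sup>L lborel (f N)) \<longlonglongrightarrow> 0"
    using LIMSEQ_offset[of "\<lambda>N. integral\<^sup>L lborel (f N)" N0] by simp
  moreover have "\<forall>\<^sub>F N in sequentially. integral\<^sup>L lborel (f N) = real N * vren (\<kappa> N) (\<nu> N) - Gth th (real (\<nu> N) / real N)"
    using eventually_ge_at_top[of N0]
  proof eventually_elim
    case (elim N)
    have "integral\<^sup>L lborel (f N) = (LINT x:{0<..}|lborel. real N * (exp (- (\<kappa> N * x)) * pker (\<nu> N) x) - Gint th (t N) x)"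
      by (simp add: f_def[abs_def] set_lebesgue_integral_def)
    also have "\<dots> = real N * vren (\<kappa> N) (\<nu> N) - Gth th (t N)"
      unfolding vren_def Gth_eq(3)[OF tN(3,2)[OF elim]] using tN[OF elim]
      by (subst set_integral_diff(2)) (auto intro!: set_integrable_mult_right pker_integrable Gint_integrable)
    finally show ?case by (simp add: t_def)
  qed
  ultimately show ?thesis using tendsto_cong by fastforce
qed

lemma vren_uniform:
  fixes \<kappa> :: "nat \<Rightarrow> real"
  assumes \<kappa>: "(\<lambda>N. \<kappa> N - ln (real N)) \<longlonglongrightarrow> euler_mascheroni - th"
    and d: "0 < d" and e: "0 < e"
  shows "\<forall>\<^sub>F N in sequentially. \<forall>n. d * real N \<le> real n \<and> n \<le> N \<longrightarrow>
     \<bar>real N * vren (\<kappa> N) n - Gth th (real n / real N)\<bar> \<le> e"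
proof -
  define P where "P N n \<longleftrightarrow> d * real N \<le> real n \<and> n \<le> N \<and> \<bar>real N * vren (\<kappa> N) n - Gth th (real n / real N)\<bar> > e" for N n
  define \<nu> where "\<nu> N = (if \<exists>n. P N n then SOME n. P N n else N)" for N
  have \<nu>P: "P N (\<nu> N)" if "\<exists>n. P N n" for N
    using someI_ex[OF that] that by (simp add: \<nu>_def)
  have "min d 1 * real N \<le> real (\<nu> N)" "\<nu> N \<le> N" for N
  proof -
    have "min d 1 * real N \<le> d * real N" "min d 1 * real N \<le> 1 * real N"
      by (intro mult_right_mono; simp)+
    moreover have "P N (\<nu> N) \<or> \<nu> N = N" using \<nu>P[of N] by (auto simp: \<nu>_def)
    ultimately show "min d 1 * real N \<le> real (\<nu> N)" "\<nu> N \<le> N"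
      by (auto simp: P_def)
  qed
  then have "(\<lambda>N. real N * vren (\<kappa> N) (\<nu> N) - Gth th (real (\<nu> N) / real N)) \<longlonglongrightarrow> 0"
    using d by (intro vren_LIMSEQ[OF \<kappa>, of "min d 1"]) auto
  from tendstoD[OF this e] show ?thesis
  proof eventually_elim
    case (elim N)
    then have "\<not> P N (\<nu> N)" by (simp add: P_def)
    then have "\<not> (\<exists>n. P N n)" using \<nu>P by blast
    then show ?case by (auto simp: P_def not_less)
  qed
qed

lemma renewal_asymptotics:
  fixes s :: "nat \<Rightarrow> real" and w :: "nat \<Rightarrow> nat \<Rightarrow> real"
  assumes w: "\<And>N n. w N n = ret2 n + s N * (\<Sum>m=1..n-1. w N m * ret2 (n - m))"
    and \<kappa>: "(\<lambda>N. pi / s N - dev_sum - ln (real N)) \<longlonglongrightarrow> l"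
    and s: "\<forall>\<^sub>F N in sequentially. s N > 0"
  shows "\<exists>M>0. \<forall>\<^sub>F N in sequentially. \<forall>n. 1 \<le> n \<longrightarrow> n \<le> N \<longrightarrow>
     \<bar>(s N)\<^sup>2 / pi * w N n\<bar> \<le> M * decay N n \<and>
     \<bar>(s N)\<^sup>2 / pi * w N n - vren (pi / s N - dev_sum) n\<bar> \<le> (M / (1 + ln (real N)) + M / sqrt (real n)) * decay N n"
proof -
  define c where "c = \<bar>l\<bar> + 1"
  have c: "c \<ge> 0" by (simp add: c_def)
  obtain C where C: "C > 0" and vb: "\<And>N k. 2 * c + 1 \<le> ln (real N) \<Longrightarrow> ln (real N) - c \<le> k \<Longrightarrow>
     vren k 0 \<le> C / (1 + ln (real N)) \<and>
     (\<forall>n. 1 \<le> n \<longrightarrow> n \<le> N \<longrightarrow> vren k n \<le> C / (real n * (ell N n)\<^sup>2)) \<and>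
     (\<forall>n. 2 \<le> n \<longrightarrow> n \<le> N \<longrightarrow> \<bar>vren k n - vren k (n - 1)\<bar> \<le> C / ((real n)\<^sup>2 * (ell N n)\<^sup>2))"
    using vren_bounds[OF c] by blast
  define D where "D = 240 * C"
  define M where "M = 2 * (C + 2 * C * D) + 13 * D * (2 * (C + 2 * C * D)) + 2 * C * D"
  have CD: "C * D > 0" "D > 0" using C by (simp_all add: D_def)
  have M: "2 * (C + 2 * C * D) \<le> M" "13 * D * (2 * (C + 2 * C * D)) \<le> M" "2 * C * D \<le> M" "M > 0"
    using C CD by (simp_all add: M_def add_pos_pos)
  have "\<forall>\<^sub>F N in sequentially. \<bar>pi / s N - dev_sum - ln (real N) - l\<bar> < 1"
    using tendstoD[OF \<kappa>, of 1] by (simp add: dist_real_def)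
  then have "\<forall>\<^sub>F N in sequentially. \<forall>n. 1 \<le> n \<longrightarrow> n \<le> N \<longrightarrow>
     \<bar>(s N)\<^sup>2 / pi * w N n\<bar> \<le> M * decay N n \<and>
     \<bar>(s N)\<^sup>2 / pi * w N n - vren (pi / s N - dev_sum) n\<bar> \<le> (M / (1 + ln (real N)) + M / sqrt (real n)) * decay N n"
    using s eventually_ge_at_top[of 1]
      filterlim_at_top[THEN iffD1, OF ln_at_top, rule_format, of "2 * c + 1"]
      filterlim_at_top[THEN iffD1, OF ln_at_top, rule_format, of "48 * D"]
  proof eventually_elim
    case (elim N)
    define k where "k = pi / s N - dev_sum"
    define \<Lambda> where "\<Lambda> = 1 + ln (real N)"
    have kN: "ln (real N) - c \<le> k" using elim(1) unfolding c_def k_def by linarith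
    have k0: "k > 0" using kN elim(4) c by linarith
    have \<Lambda>: "\<Lambda> \<ge> 1" using elim(3) by (simp add: \<Lambda>_def)
    note vbN = vb[OF elim(4) kN]
    have v0: "\<bar>vren k 0\<bar> \<le> C / \<Lambda>" using vbN vren_nonneg[of k 0] by (simp add: \<Lambda>_def)
    have v: "\<bar>vren k n\<bar> \<le> C * decay N n" if "1 \<le> n" "n \<le> N" for n
      using vbN that vren_nonneg[of k n] by (simp add: decay_def)
    have dv: "\<bar>vren k n - vren k (n - 1)\<bar> \<le> C * decay N n / real n" if "2 \<le> n" "n \<le> N" for n
      using vbN that by (simp add: decay_def power2_eq_square mult_ac)
    define h where "h n = (\<Sum>j\<le>n. dev j * vren k (n - j))" for n
    define u where "u n = (if n = 0 then s N / pi else (s N)\<^sup>2 / pi * w N n)" for n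
    have u: "u n = vren k n + (\<Sum>j\<le>n. h j * u (n - j))" for n
      unfolding h_def u_def
      by (rule renewal_transform[OF _ w k_def k0]) (use elim(2) in simp)
    have h0: "\<bar>h 0\<bar> \<le> D / \<Lambda>"
    proof -
      have "\<bar>h 0\<bar> \<le> 2 * (C / \<Lambda>)"
        unfolding h_def using mult_mono[OF abs_dev_0_le v0] by (simp add: abs_mult)
      also have "\<dots> \<le> D / \<Lambda>" using C \<Lambda> by (simp add: D_def divide_right_mono)
      finally show ?thesis .
    qed
    have h: "\<bar>h n\<bar> \<le> D / (\<Lambda> * (real n * sqrt (real n)))" if "1 \<le> n" "n \<le> N" for n
      unfolding h_def D_def \<Lambda>_def
      using C v0 v dv that by (intro dev_conv_bound) (auto simp: \<Lambda>_def)
    show ?case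
    proof (intro allI impI)
      fix n assume n: "1 \<le> n" "n \<le> N"
      have big: "48 * D \<le> 1 + ln (real N)" using elim(5) by simp
      have un: "u n = (s N)\<^sup>2 / pi * w N n" using n by (simp add: u_def)
      have B: "decay N n > 0" by (rule decay_pos[OF n])
      have 1: "\<bar>u n\<bar> \<le> 2 * (C + 2 * C * D) * decay N n"
        and 2: "\<bar>u n - vren k n\<bar> \<le> (13 * D * (2 * (C + 2 * C * D)) / \<Lambda> + 2 * C * D / sqrt (real n)) * decay N n"
        unfolding \<Lambda>_def
        by (rule renewal_perturbation[OF u less_imp_le[OF C] less_imp_le[OF CD(2)] elim(3)
              v0[unfolded \<Lambda>_def] v h0[unfolded \<Lambda>_def] h[unfolded \<Lambda>_def] big n], assumption+)+
      note 1
      also have "2 * (C + 2 * C * D) * decay N n \<le> M * decay N n" using M B by (intro mult_right_mono) auto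
      finally have 3: "\<bar>u n\<bar> \<le> M * decay N n" .
      note 2
      also have "(13 * D * (2 * (C + 2 * C * D)) / \<Lambda> + 2 * C * D / sqrt (real n)) * decay N n \<le>
          (M / \<Lambda> + M / sqrt (real n)) * decay N n"
        using M B \<Lambda> by (intro mult_right_mono add_mono divide_right_mono) auto
      finally show "\<bar>(s N)\<^sup>2 / pi * w N n\<bar> \<le> M * decay N n \<and>
         \<bar>(s N)\<^sup>2 / pi * w N n - vren (pi / s N - dev_sum) n\<bar> \<le> (M / (1 + ln (real N)) + M / sqrt (real n)) * decay N n"
        using 3 by (simp add: un k_def \<Lambda>_def)
    qed
  qed
  then show ?thesis using M(4) by blast
qed

lemma Gth_ge_decay:
  "\<exists>c>0. \<forall>N n. 1 \<le> n \<longrightarrow> n \<le> N \<longrightarrow> c * (real N * decay N n) \<le> Gth th (real n / real N)"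
proof -
  obtain c where c: "c > 0" "\<And>t. 0 < t \<Longrightarrow> t \<le> 1 \<Longrightarrow> c / (t * (1 + ln (1 / t))\<^sup>2) \<le> Gth th t"
    using Gth_lower_bound[of th] by blast
  have "c * (real N * decay N n) \<le> Gth th (real n / real N)" if "1 \<le> n" "n \<le> N" for N n
    using c(2)[of "real n / real N"] that by (simp add: decay_def ell_def)
  then show ?thesis using c(1) by blast
qed

theorem mainTheorem10:
  fixes mu :: "real measure" and th :: real and beta :: "nat \<Rightarrow> real"
  assumes "prob_space mu" and "sets mu = sets borel"
    and "integrable mu (\<lambda>x. x)" and "integrable mu (\<lambda>x. x^2)"
    and "(\<integral>x. x \<partial>mu) = 0" and "(\<integral>x. x^2 \<partial>mu) = 1"
    and "\<And>b. b > 0 \<Longrightarrow> integrable mu (\<lambda>x. exp (b * x))"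
    and "\<And>N. beta N > 0"
    and "\<exists>eps. eps \<longlonglongrightarrow> 0 \<and>
           (\<forall>\<^sub>F N in sequentially.
              sigma2 mu (beta N) = (1 / RN N) * (1 + th / ln (real N) * (1 + eps N)))"
  shows "(\<forall>delta>0. \<forall>eta>0. \<forall>\<^sub>F N in sequentially. \<forall>n.
            delta * real N \<le> real n \<and> n \<le> N \<longrightarrow>
              \<bar>Z2 mu (beta N) n - (ln (real N))^2 / (pi * real N) * Gth th (real n / real N)\<bar>
                \<le> eta * ((ln (real N))^2 / (pi * real N) * Gth th (real n / real N)))
       \<and> (\<exists>C>0. \<forall>N\<ge>2. \<forall>n. 1 \<le> n \<and> n \<le> N \<longrightarrow>
              Z2 mu (beta N) n \<le> C * (ln (real N))^2 / real N * Gth th (real n / real N))"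
proof -
  define s where "s N = sigma2 mu (beta N)" for N
  define w where "w N n = Z2 mu (beta N) n" for N n
  define \<kappa> where "\<kappa> N = pi / s N - dev_sum" for N
  define r where "r N = (pi / s N / ln (real N))\<^sup>2" for N
  obtain eps where eps: "eps \<longlonglongrightarrow> 0"
    "\<forall>\<^sub>F N in sequentially. s N = 1 / (\<Sum>n=1..N. ret2 n) * (1 + th / ln (real N) * (1 + eps N))"
    using assms(9) by (auto simp: s_def RN_eq)
  have w: "w N n = ret2 n + s N * (\<Sum>m=1..n-1. w N m * ret2 (n - m))" for N n
    unfolding w_def s_def using Z2_renewal[OF assms(1,7) assms(8)] by blast
  note kappa_asymp = kappa_asymp[OF eps]
  obtain M where M: "M > 0" and asymp: "\<forall>\<^sub>F N in sequentially. \<forall>n. 1 \<le> n \<longrightarrow> n \<le> N \<longrightarrow>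
     \<bar>(s N)\<^sup>2 / pi * w N n\<bar> \<le> M * decay N n \<and>
     \<bar>(s N)\<^sup>2 / pi * w N n - vren (\<kappa> N) n\<bar> \<le> (M / (1 + ln (real N)) + M / sqrt (real n)) * decay N n"
    using renewal_asymptotics[OF w kappa_asymp(1,3)] unfolding \<kappa>_def by blast
  obtain c where c: "c > 0" "\<And>N n. 1 \<le> n \<Longrightarrow> n \<le> N \<Longrightarrow> c * (real N * decay N n) \<le> Gth th (real n / real N)"
    using Gth_ge_decay[of th] by blast
  have r: "r \<longlonglongrightarrow> 1" unfolding r_def[abs_def] using tendsto_power[OF kappa_asymp(2), of 2] by simp
  have w_r: "w N n = (ln (real N))\<^sup>2 / pi * (r N * ((s N)\<^sup>2 / pi * w N n))" if "s N > 0" "N \<ge> 2" for N n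
  proof -
    have "ln (real N) \<noteq> 0" using that(2) by simp
    then show ?thesis using that(1) by (simp add: r_def field_simps power2_eq_square)
  qed
  show ?thesis
  proof (intro conjI allI impI)
    fix delta eta :: real assume delta: "delta > 0" and eta: "eta > 0"
    define d where "d = min delta 1"
    have d: "0 < d" "d \<le> 1" using delta by (auto simp: d_def)
    define g where "g = c / (1 + ln (1 / d))\<^sup>2"
    have lnd: "ln (1 / d) \<ge> 0" using d by simp
    have g: "g > 0" using c(1) lnd by (simp add: g_def)
    define e where "e = eta * g / 8"
    have e: "e > 0" using eta g by (simp add: e_def)
    have vu: "\<forall>\<^sub>F N in sequentially. \<forall>n. d * real N \<le> real n \<and> n \<le> N \<longrightarrow>
       \<bar>real N * vren (\<kappa> N) n - Gth th (real n / real N)\<bar> \<le> e"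
      using kappa_asymp(1) d e by (intro vren_uniform) (auto simp: \<kappa>_def)
    have err: "\<forall>\<^sub>F N in sequentially. (M / (1 + ln (real N)) + M / sqrt (d * real N)) / d < e"
    proof -
      have "(\<lambda>N. (M / (1 + ln (real N)) + M / sqrt (d * real N)) / d) \<longlonglongrightarrow> 0" using d by real_asymp
      from order_tendstoD(2)[OF this e] show ?thesis .
    qed
    have rb: "\<forall>\<^sub>F N in sequentially. \<bar>r N - 1\<bar> < min 1 (eta / 2)"
      using tendstoD[OF r, of "min 1 (eta / 2)"] eta by (simp add: dist_real_def)
    show "\<forall>\<^sub>F N in sequentially. \<forall>n. delta * real N \<le> real n \<and> n \<le> N \<longrightarrow>
              \<bar>Z2 mu (beta N) n - (ln (real N))^2 / (pi * real N) * Gth th (real n / real N)\<bar>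
                \<le> eta * ((ln (real N))^2 / (pi * real N) * Gth th (real n / real N))"
      using vu err rb asymp kappa_asymp(3) eventually_ge_at_top[of 2]
    proof eventually_elim
      case (elim N)
      show ?case
      proof (intro allI impI)
        fix n assume "delta * real N \<le> real n \<and> n \<le> N"
        moreover have "d * real N \<le> delta * real N" by (intro mult_right_mono) (auto simp: d_def)
        ultimately have n: "d * real N \<le> real n" "n \<le> N" by auto
        have N: "real N > 0" using elim(6) by simp
        have dN: "d * real N > 0" using d N by simp
        have n1: "1 \<le> n" using n dN by (cases n) auto
        define G where "G = Gth th (real n / real N)"
        define u where "u = (s N)\<^sup>2 / pi * w N n"
        have "ell N n \<ge> 1" by (rule ell_ge_1[OF n1 n(2)])
        have NB: "real N * decay N n \<le> 1 / d"
        proof -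
          have "real N * decay N n = (real N / real n) * (1 / (ell N n)\<^sup>2)" by (simp add: decay_def)
          also have "\<dots> \<le> (1 / d) * 1"
            using n d n1 \<open>ell N n \<ge> 1\<close> by (intro mult_mono) (auto simp: field_simps)
          finally show ?thesis by simp
        qed
        have B: "decay N n > 0" by (rule decay_pos[OF n1 n(2)])
        have gG: "g \<le> G"
        proof -
          have "ln (real N / real n) \<le> ln (1 / d)"
            using n n1 N d by (intro ln_mono) (auto simp: field_simps)
          then have l: "ell N n \<le> 1 + ln (1 / d)" by (simp add: ell_def)
          have "1 / (1 + ln (1 / d))\<^sup>2 \<le> (real N / real n) * (1 / (ell N n)\<^sup>2)"
          proof -
            have "1 / (1 + ln (1 / d))\<^sup>2 \<le> 1 * (1 / (ell N n)\<^sup>2)"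
              using l \<open>ell N n \<ge> 1\<close> by (simp add: divide_left_mono power_mono)
            also have "\<dots> \<le> (real N / real n) * (1 / (ell N n)\<^sup>2)"
              using n n1 by (intro mult_right_mono) auto
            finally show ?thesis .
          qed
          then have "c * (1 / (1 + ln (1 / d))\<^sup>2) \<le> c * (real N * decay N n)"
            using c(1) by (intro mult_left_mono) (auto simp: decay_def)
          also have "\<dots> \<le> G" unfolding G_def by (rule c(2)[OF n1 n(2)])
          finally show ?thesis by (simp add: g_def)
        qed
        have "\<bar>real N * u - real N * vren (\<kappa> N) n\<bar> = real N * \<bar>u - vren (\<kappa> N) n\<bar>"
          by (simp add: right_diff_distrib[symmetric] abs_mult)
        also have "\<dots> \<le> real N * ((M / (1 + ln (real N)) + M / sqrt (real n)) * decay N n)"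
          using elim(4) n1 n by (intro mult_left_mono) (auto simp: u_def)
        also have "\<dots> = (M / (1 + ln (real N)) + M / sqrt (real n)) * (real N * decay N n)" by simp
        also have "\<dots> \<le> (M / (1 + ln (real N)) + M / sqrt (d * real N)) * (1 / d)"
          using M B N n n1 dN NB by (intro mult_mono add_mono order_refl divide_left_mono) auto
        also have "\<dots> < e" using elim(2) by simp
        finally have "\<bar>real N * u - real N * vren (\<kappa> N) n\<bar> < e" .
        moreover have "\<bar>real N * vren (\<kappa> N) n - G\<bar> \<le> e" unfolding G_def using elim(1) n by blast
        ultimately have uG: "\<bar>real N * u - G\<bar> \<le> 2 * e" by linarith
        have "\<bar>r N * (real N * u) - G\<bar> = \<bar>r N * (real N * u - G) + (r N - 1) * G\<bar>"
          by (simp add: algebra_simps)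
        also have "\<dots> \<le> \<bar>r N\<bar> * \<bar>real N * u - G\<bar> + \<bar>r N - 1\<bar> * \<bar>G\<bar>"
          by (metis abs_mult abs_triangle_ineq)
        also have "\<dots> \<le> 2 * (2 * e) + eta / 2 * G"
          using elim(3) uG gG g eta by (intro add_mono mult_mono) auto
        also have "\<dots> \<le> eta * G"
        proof -
          have "eta * g \<le> eta * G" using gG eta by (intro mult_left_mono) auto
          then show ?thesis by (simp add: e_def)
        qed
        finally have main: "\<bar>r N * (real N * u) - G\<bar> \<le> eta * G" .
        define q where "q = (ln (real N))\<^sup>2 / (pi * real N)"
        have q: "q \<ge> 0" by (simp add: q_def)
        have "w N n = q * (r N * (real N * u))"
          using w_r[OF elim(5,6), of n] N by (simp add: q_def u_def)
        then have "\<bar>w N n - q * G\<bar> = q * \<bar>r N * (real N * u) - G\<bar>"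
          using q by (simp add: right_diff_distrib[symmetric] abs_mult)
        also have "\<dots> \<le> q * (eta * G)" using main q by (rule mult_left_mono)
        finally show "\<bar>Z2 mu (beta N) n - (ln (real N))^2 / (pi * real N) * Gth th (real n / real N)\<bar>
                \<le> eta * ((ln (real N))^2 / (pi * real N) * Gth th (real n / real N))"
          by (simp add: w_def q_def G_def mult_ac)
      qed
    qed
  next
    define F where "F N n = (ln (real N))\<^sup>2 / real N * Gth th (real n / real N)" for N n
    have Fpos: "F N n > 0" if "N \<ge> 2" "1 \<le> n" "n \<le> N" for N n
    proof -
      have "0 < c * (real N * decay N n)" using c(1) that decay_pos[of n N] by simp
      also have "\<dots> \<le> Gth th (real n / real N)" using that by (intro c(2))
      finally show ?thesis using that by (simp add: F_def)
    qed
    have "\<forall>\<^sub>F N in sequentially. \<bar>r N - 1\<bar> < 1"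
      using tendstoD[OF r, of 1] by (simp add: dist_real_def)
    then have "\<forall>\<^sub>F N in sequentially. \<forall>n. 1 \<le> n \<and> n \<le> N \<longrightarrow> w N n \<le> 2 * M / (c * pi) * F N n"
      using asymp kappa_asymp(3) eventually_ge_at_top[of 2]
    proof eventually_elim
      case (elim N)
      show ?case
      proof (intro allI impI)
        fix n assume n: "1 \<le> n \<and> n \<le> N"
        have B: "decay N n > 0" using n by (intro decay_pos) auto
        have "r N * ((s N)\<^sup>2 / pi * w N n) \<le> \<bar>r N\<bar> * \<bar>(s N)\<^sup>2 / pi * w N n\<bar>"
          by (metis abs_ge_self abs_mult)
        also have "\<dots> \<le> 2 * (M * decay N n)"
          using elim(1,2) n M B by (intro mult_mono) auto
        also have "\<dots> \<le> 2 * M / c * (Gth th (real n / real N) / real N)"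
          using c(2)[of n N] n c(1) M elim(4) by (simp add: field_simps)
        finally have "(ln (real N))\<^sup>2 / pi * (r N * ((s N)\<^sup>2 / pi * w N n)) \<le>
            (ln (real N))\<^sup>2 / pi * (2 * M / c * (Gth th (real n / real N) / real N))"
          by (rule mult_left_mono) simp
        then show "w N n \<le> 2 * M / (c * pi) * F N n"
          using w_r[OF elim(3,4), of n] by (simp add: F_def mult_ac)
      qed
    qed
    then obtain N0 where N0: "\<And>N n. N \<ge> N0 \<Longrightarrow> 1 \<le> n \<Longrightarrow> n \<le> N \<Longrightarrow> w N n \<le> 2 * M / (c * pi) * F N n"
      by (auto simp: eventually_sequentially)
    define C where "C = 2 * M / (c * pi) + (\<Sum>N\<in>{2..N0}. \<Sum>n\<in>{1..N}. \<bar>w N n / F N n\<bar>)"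
    have rest_nonneg: "(\<Sum>N\<in>{2..N0}. \<Sum>n\<in>{1..N}. \<bar>w N n / F N n\<bar>) \<ge> 0"
      by (intro sum_nonneg) auto
    have "2 * M / (c * pi) > 0" using M c(1) by simp
    then have C: "C > 0" using rest_nonneg by (simp add: C_def)
    have "w N n \<le> C * F N n" if N: "N \<ge> 2" and n: "1 \<le> n" "n \<le> N" for N n
    proof (cases "N \<ge> N0")
      case True
      have "w N n \<le> 2 * M / (c * pi) * F N n" using N0[OF True n] .
      also have "\<dots> \<le> C * F N n"
        using Fpos[OF N n] rest_nonneg by (intro mult_right_mono) (auto simp: C_def)
      finally show ?thesis .
    next
      case False
      have "\<bar>w N n / F N n\<bar> \<le> (\<Sum>n\<in>{1..N}. \<bar>w N n / F N n\<bar>)"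
        using n by (intro member_le_sum) auto
      also have "\<dots> \<le> (\<Sum>N\<in>{2..N0}. \<Sum>n\<in>{1..N}. \<bar>w N n / F N n\<bar>)"
        using N False by (intro member_le_sum[of N _ "\<lambda>N. \<Sum>n\<in>{1..N}. \<bar>w N n / F N n\<bar>"]) (auto intro: sum_nonneg)
      also have "\<dots> \<le> C" using M c(1) by (simp add: C_def)
      finally have "w N n / F N n \<le> C" by (rule abs_le_D1)
      then show ?thesis using Fpos[OF N n] by (simp add: divide_le_eq)
    qed
    then show "\<exists>C>0. \<forall>N\<ge>2. \<forall>n. 1 \<le> n \<and> n \<le> N \<longrightarrow>
              Z2 mu (beta N) n \<le> C * (ln (real N))^2 / real N * Gth th (real n / real N)"
      using C by (intro exI[of _ C]) (auto simp: F_def w_def mult.assoc)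
  qed
qed

end
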